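(* Let $A$ and $A'$ be gauge equivalent semisimple Hopf algebras over the field $\Bbbk$ with (nonzero) idempotent integrals $\Lambda$ and $\Lambda'$ respectively. For any polynomial $\psi(X_1,\dots,X_s)\in\Bbbk[X_1,\dots,X_s]$ and any $n_1,\dots,n_s\in\mathbb{Z}$, we have $\psi(P_{n_1}(\Lambda),\dots,P_{n_s}(\Lambda))=0$ if and only if $\psi(P'_{n_1}(\Lambda'),\dots,P'_{n_s}(\Lambda'))=0$.
   Context: $\Bbbk$ is an arbitrary field and Hopf algebras are finite-dimensional. Two Hopf algebras $A,A'$ over $\Bbbk$ are gauge equivalent if their categories of finite-dimensional left modules are equivalent as ($\Bbbk$-linear) tensor categories. An integral $\Lambda\in A$ satisfies $a\Lambda=\varepsilon(a)\Lambda$ for all $a\in A$ (a semisimple Hopf algebra is unimodular, so left and right integrals coincide); idempotent means $\Lambda^2=\Lambda$. For a Hopf algebra $A$ with comultiplication $\Delta(a)=a_{(1)}\otimes a_{(2)}$, counit $\varepsilon$ and antipode $S$, the $n$-th Sweedler power map $P_n:A\to A$ is $P_n(a)=a_{(1)}\cdots a_{(n)}$ for $n\ge1$, $P_0(a)=\varepsilon(a)1$, and $P_n(a)=S(a_{(-n)}\cdots a_{(1)})$ for $n\le-1$ (the factors being the $|n|$ tensor legs of the iterated comultiplication of $a$, multiplied in decreasing order of index). $P_n$ and $P'_n$ are the $n$-th Sweedler power maps of $A$ and $A'$. (The elements $P_n(\Lambda)$ are central, so polynomial evaluation is unambiguous.) *)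

theory Defs
  imports "HOL-Library.Poly_Mapping" "HOL-Library.Multiset" "Jordan_Normal_Form.Matrix"
begin

text \<open>
  A pure tensor \<open>x\<^sub>1 \<otimes> \<dots> \<otimes> x\<^sub>n\<close> is written as the list \<open>[x\<^sub>1, \<dots>, x\<^sub>n]\<close>, and an element of the tensor
  power \<open>A\<^sup>\<otimes>\<^sup>n\<close> (\<open>n \<ge> 1\<close>) is written as a finite formal sum (a list) of pure tensors. Two formal sums
  denote the same element iff they are identified by the congruence generated by the multilinearity
  relations, i.e. \<open>A\<^sup>\<otimes>\<^sup>n\<close> is the usual quotient of a free commutative monoid on \<open>n\<close>-tuples. (It is a
  group, since \<open>[- x, y]\<close> is inverse to \<open>[x, y]\<close> by the first two rules.)
\<close>

inductive tensor_eq :: "('k::field \<Rightarrow> 'a::ring_1 \<Rightarrow> 'a) \<Rightarrow> 'a list list \<Rightarrow> 'a list list \<Rightarrow> bool"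
  for scale :: "'k \<Rightarrow> 'a \<Rightarrow> 'a" where
  additive: "tensor_eq scale [us @ (x + y) # vs] [us @ x # vs, us @ y # vs]"
| zero: "tensor_eq scale [us @ 0 # vs] []"
| balanced: "tensor_eq scale [us @ scale c x # vs @ y # ws] [us @ x # vs @ scale c y # ws]"
| reorder: "mset s = mset t \<Longrightarrow> tensor_eq scale s t"
| append: "tensor_eq scale s t \<Longrightarrow> tensor_eq scale s' t' \<Longrightarrow> tensor_eq scale (s @ s') (t @ t')"
| sym: "tensor_eq scale s t \<Longrightarrow> tensor_eq scale t s"
| trans: "tensor_eq scale s t \<Longrightarrow> tensor_eq scale t u \<Longrightarrow> tensor_eq scale s u"

locale fd_algebra = vector_space scale
  for scale :: "'k::field \<Rightarrow> 'a::ring_1 \<Rightarrow> 'a" +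
  assumes scale_mult_left: "scale c x * y = scale c (x * y)"
    and scale_mult_right: "x * scale c y = scale c (x * y)"
    and finite_dimensional: "\<exists>B. finite B \<and> span B = UNIV"

text \<open>
  \<open>\<Delta> a\<close> lists the pairs \<open>(a\<^sub>(\<^sub>1\<^sub>), a\<^sub>(\<^sub>2\<^sub>))\<close> of a chosen expression of the comultiplication of \<open>a\<close> as a sum
  of pure tensors. Only its class in \<open>A \<otimes> A\<close> is subject to the axioms.
\<close>

locale hopf_algebra = fd_algebra scale
  for scale :: "'k::field \<Rightarrow> 'a::ring_1 \<Rightarrow> 'a"
    and \<Delta> :: "'a \<Rightarrow> ('a \<times> 'a) list"
    and \<epsilon> :: "'a \<Rightarrow> 'k"
    and S :: "'a \<Rightarrow> 'a" +
  assumes comult_add: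
      "tensor_eq scale [[x, y]. (x, y) \<leftarrow> \<Delta> (a + b)] [[x, y]. (x, y) \<leftarrow> \<Delta> a @ \<Delta> b]"
    and comult_scale:
      "tensor_eq scale [[x, y]. (x, y) \<leftarrow> \<Delta> (scale c a)] [[scale c x, y]. (x, y) \<leftarrow> \<Delta> a]"
    and comult_mult:
      "tensor_eq scale [[x, y]. (x, y) \<leftarrow> \<Delta> (a * b)]
        [[x * x', y * y']. (x, y) \<leftarrow> \<Delta> a, (x', y') \<leftarrow> \<Delta> b]"
    and comult_one: "tensor_eq scale [[x, y]. (x, y) \<leftarrow> \<Delta> 1] [[1, 1]]"
    and coassoc:
      "tensor_eq scale [[x, y, z]. (u, z) \<leftarrow> \<Delta> a, (x, y) \<leftarrow> \<Delta> u]
        [[x, y, z]. (x, u) \<leftarrow> \<Delta> a, (y, z) \<leftarrow> \<Delta> u]"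
    and counit_add: "\<epsilon> (a + b) = \<epsilon> a + \<epsilon> b"
    and counit_scale: "\<epsilon> (scale c a) = c * \<epsilon> a"
    and counit_mult: "\<epsilon> (a * b) = \<epsilon> a * \<epsilon> b"
    and counit_one: "\<epsilon> 1 = 1"
    and counit_left: "(\<Sum>(x, y)\<leftarrow>\<Delta> a. scale (\<epsilon> x) y) = a"
    and counit_right: "(\<Sum>(x, y)\<leftarrow>\<Delta> a. scale (\<epsilon> y) x) = a"
    and antipode_add: "S (a + b) = S a + S b"
    and antipode_scale: "S (scale c a) = scale c (S a)"
    and antipode_left: "(\<Sum>(x, y)\<leftarrow>\<Delta> a. S x * y) = scale (\<epsilon> a) 1"
    and antipode_right: "(\<Sum>(x, y)\<leftarrow>\<Delta> a. x * S y) = scale (\<epsilon> a) 1"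

definition left_ideal :: "'a::ring_1 set \<Rightarrow> bool" where
  "left_ideal I \<longleftrightarrow> 0 \<in> I \<and> (\<forall>x\<in>I. \<forall>y\<in>I. x + y \<in> I) \<and> (\<forall>a. \<forall>x\<in>I. a * x \<in> I)"

text \<open>The left regular module is semisimple: each submodule is a direct summand.\<close>

definition semisimple_ring :: "'a::ring_1 itself \<Rightarrow> bool" where
  "semisimple_ring _ \<longleftrightarrow> (\<forall>I :: 'a set. left_ideal I \<longrightarrow>
     (\<exists>J. left_ideal J \<and> I \<inter> J = {0} \<and> (\<forall>a. \<exists>x\<in>I. \<exists>y\<in>J. a = x + y)))"

definition is_left_integral ::
  "('k::field \<Rightarrow> 'a::ring_1 \<Rightarrow> 'a) \<Rightarrow> ('a \<Rightarrow> 'k) \<Rightarrow> 'a \<Rightarrow> bool" where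
  "is_left_integral scale \<epsilon> \<Lambda> \<longleftrightarrow> (\<forall>a. a * \<Lambda> = scale (\<epsilon> a) \<Lambda>)"

text \<open>\<open>iterated_comult \<Delta> m a\<close> applies \<open>m\<close> comultiplications, so its terms have \<open>m + 1\<close> legs.\<close>

primrec iterated_comult :: "('a \<Rightarrow> ('a \<times> 'a) list) \<Rightarrow> nat \<Rightarrow> 'a \<Rightarrow> 'a list list" where
  "iterated_comult \<Delta> 0 a = [[a]]"
| "iterated_comult \<Delta> (Suc m) a = [x # t. (x, y) \<leftarrow> \<Delta> a, t \<leftarrow> iterated_comult \<Delta> m y]"

definition sweedler_power ::
  "('k::field \<Rightarrow> 'a::ring_1 \<Rightarrow> 'a) \<Rightarrow> ('a \<Rightarrow> ('a \<times> 'a) list) \<Rightarrow> ('a \<Rightarrow> 'k) \<Rightarrow> ('a \<Rightarrow> 'a)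
    \<Rightarrow> int \<Rightarrow> 'a \<Rightarrow> 'a" where
  "sweedler_power scale \<Delta> \<epsilon> S n a =
    (if n \<ge> 1 then \<Sum>t\<leftarrow>iterated_comult \<Delta> (nat n - 1) a. prod_list t
     else if n = 0 then scale (\<epsilon> a) 1
     else S (\<Sum>t\<leftarrow>iterated_comult \<Delta> (nat (- n) - 1) a. prod_list (rev t)))"

text \<open>
  A polynomial in the variables \<open>X\<^sub>i\<close> (\<open>i :: nat\<close>) is a finitely supported function on monomials, a monomial
  being a finitely supported exponent function. The product in \<open>eval_polynomial\<close> is taken in the order
  \<open>x 0, \<dots>, x (s - 1)\<close>; the order is immaterial for commuting arguments.
\<close>

type_synonym 'k polynomial = "(nat \<Rightarrow>\<^sub>0 nat) \<Rightarrow>\<^sub>0 'k"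

definition polynomial_in :: "nat \<Rightarrow> 'k::field polynomial \<Rightarrow> bool" where
  "polynomial_in s \<psi> \<longleftrightarrow> (\<forall>m\<in>Poly_Mapping.keys \<psi>. Poly_Mapping.keys m \<subseteq> {..<s})"

definition eval_polynomial ::
  "('k::field \<Rightarrow> 'a::ring_1 \<Rightarrow> 'a) \<Rightarrow> nat \<Rightarrow> 'k polynomial \<Rightarrow> (nat \<Rightarrow> 'a) \<Rightarrow> 'a" where
  "eval_polynomial scale s \<psi> x =
    (\<Sum>m\<in>Poly_Mapping.keys \<psi>. scale (Poly_Mapping.lookup \<psi> m)
       (prod_list (map (\<lambda>i. x i ^ Poly_Mapping.lookup m i) [0..<s])))"

text \<open>
  Hom-sets need not be disjoint, so a morphism is always considered together with its source and
  target; \<open>compose C g f\<close> is \<open>g\<close> after \<open>f\<close>. The associator goes from \<open>(X \<otimes> Y) \<otimes> Z\<close> to \<open>X \<otimes> (Y \<otimes> Z)\<close>,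
  the unitors from \<open>1 \<otimes> X\<close> and from \<open>X \<otimes> 1\<close> to \<open>X\<close>.
\<close>

record ('o, 'm, 'k) tensor_category =
  Obj :: "'o set"
  Hom :: "'o \<Rightarrow> 'o \<Rightarrow> 'm set"
  compose :: "'m \<Rightarrow> 'm \<Rightarrow> 'm"
  ident :: "'o \<Rightarrow> 'm"
  hom_add :: "'m \<Rightarrow> 'm \<Rightarrow> 'm"
  hom_scale :: "'k \<Rightarrow> 'm \<Rightarrow> 'm"
  tensor_obj :: "'o \<Rightarrow> 'o \<Rightarrow> 'o"
  tensor_hom :: "'m \<Rightarrow> 'm \<Rightarrow> 'm"
  unit_obj :: "'o"
  associator :: "'o \<Rightarrow> 'o \<Rightarrow> 'o \<Rightarrow> 'm"
  left_unitor :: "'o \<Rightarrow> 'm"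
  right_unitor :: "'o \<Rightarrow> 'm"

definition is_iso :: "('o, 'm, 'k) tensor_category \<Rightarrow> 'o \<Rightarrow> 'o \<Rightarrow> 'm \<Rightarrow> bool" where
  "is_iso C X Y f \<longleftrightarrow> f \<in> Hom C X Y \<and>
     (\<exists>g\<in>Hom C Y X. compose C g f = ident C X \<and> compose C f g = ident C Y)"

text \<open>A functor is given by \<open>F\<close> on objects and, for \<open>f\<close> from \<open>X\<close> to \<open>Y\<close>, by \<open>Fm X Y f\<close> on morphisms.\<close>

definition linear_functor ::
  "('o, 'm, 'k) tensor_category \<Rightarrow> ('p, 'n, 'k) tensor_category
    \<Rightarrow> ('o \<Rightarrow> 'p) \<Rightarrow> ('o \<Rightarrow> 'o \<Rightarrow> 'm \<Rightarrow> 'n) \<Rightarrow> bool" where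
  "linear_functor C D F Fm \<longleftrightarrow>
     (\<forall>X\<in>Obj C. F X \<in> Obj D) \<and>
     (\<forall>X\<in>Obj C. Fm X X (ident C X) = ident D (F X)) \<and>
     (\<forall>X\<in>Obj C. \<forall>Y\<in>Obj C. \<forall>f\<in>Hom C X Y. Fm X Y f \<in> Hom D (F X) (F Y)) \<and>
     (\<forall>X\<in>Obj C. \<forall>Y\<in>Obj C. \<forall>Z\<in>Obj C. \<forall>f\<in>Hom C X Y. \<forall>g\<in>Hom C Y Z.
        Fm X Z (compose C g f) = compose D (Fm Y Z g) (Fm X Y f)) \<and>
     (\<forall>X\<in>Obj C. \<forall>Y\<in>Obj C. \<forall>f\<in>Hom C X Y. \<forall>g\<in>Hom C X Y.
        Fm X Y (hom_add C f g) = hom_add D (Fm X Y f) (Fm X Y g)) \<and>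
     (\<forall>X\<in>Obj C. \<forall>Y\<in>Obj C. \<forall>f\<in>Hom C X Y. \<forall>c.
        Fm X Y (hom_scale C c f) = hom_scale D c (Fm X Y f))"

definition natural_iso ::
  "('o, 'm, 'k) tensor_category \<Rightarrow> ('p, 'n, 'k) tensor_category
    \<Rightarrow> ('o \<Rightarrow> 'p) \<Rightarrow> ('o \<Rightarrow> 'o \<Rightarrow> 'm \<Rightarrow> 'n) \<Rightarrow> ('o \<Rightarrow> 'p) \<Rightarrow> ('o \<Rightarrow> 'o \<Rightarrow> 'm \<Rightarrow> 'n)
    \<Rightarrow> ('o \<Rightarrow> 'n) \<Rightarrow> bool" where
  "natural_iso C D F Fm G Gm \<eta> \<longleftrightarrow>
     (\<forall>X\<in>Obj C. is_iso D (F X) (G X) (\<eta> X)) \<and>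
     (\<forall>X\<in>Obj C. \<forall>Y\<in>Obj C. \<forall>f\<in>Hom C X Y.
        compose D (\<eta> Y) (Fm X Y f) = compose D (Gm X Y f) (\<eta> X))"

definition linear_equivalence ::
  "('o, 'm, 'k) tensor_category \<Rightarrow> ('p, 'n, 'k) tensor_category
    \<Rightarrow> ('o \<Rightarrow> 'p) \<Rightarrow> ('o \<Rightarrow> 'o \<Rightarrow> 'm \<Rightarrow> 'n) \<Rightarrow> bool" where
  "linear_equivalence C D F Fm \<longleftrightarrow> linear_functor C D F Fm \<and>
     (\<exists>G Gm \<eta> \<theta>. linear_functor D C G Gm \<and>
        natural_iso C C (\<lambda>X. X) (\<lambda>X Y f. f) (\<lambda>X. G (F X)) (\<lambda>X Y f. Gm (F X) (F Y) (Fm X Y f)) \<eta> \<and>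
        natural_iso D D (\<lambda>X. F (G X)) (\<lambda>X Y f. Fm (G X) (G Y) (Gm X Y f)) (\<lambda>X. X) (\<lambda>X Y f. f) \<theta>)"

text \<open>
  A (strong) tensor structure on a functor: natural isomorphisms \<open>J X Y : F X \<otimes> F Y \<rightarrow> F (X \<otimes> Y)\<close> and an
  isomorphism \<open>j : 1 \<rightarrow> F 1\<close>, compatible with the associators and the unitors.
\<close>

definition tensor_structure ::
  "('o, 'm, 'k) tensor_category \<Rightarrow> ('p, 'n, 'k) tensor_category
    \<Rightarrow> ('o \<Rightarrow> 'p) \<Rightarrow> ('o \<Rightarrow> 'o \<Rightarrow> 'm \<Rightarrow> 'n) \<Rightarrow> ('o \<Rightarrow> 'o \<Rightarrow> 'n) \<Rightarrow> 'n \<Rightarrow> bool" where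
  "tensor_structure C D F Fm J j \<longleftrightarrow>
     (\<forall>X\<in>Obj C. \<forall>Y\<in>Obj C.
        is_iso D (tensor_obj D (F X) (F Y)) (F (tensor_obj C X Y)) (J X Y)) \<and>
     is_iso D (unit_obj D) (F (unit_obj C)) j \<and>
     (\<forall>X\<in>Obj C. \<forall>X'\<in>Obj C. \<forall>Y\<in>Obj C. \<forall>Y'\<in>Obj C. \<forall>f\<in>Hom C X X'. \<forall>g\<in>Hom C Y Y'.
        compose D (J X' Y') (tensor_hom D (Fm X X' f) (Fm Y Y' g)) =
        compose D (Fm (tensor_obj C X Y) (tensor_obj C X' Y') (tensor_hom C f g)) (J X Y)) \<and>
     (\<forall>X\<in>Obj C. \<forall>Y\<in>Obj C. \<forall>Z\<in>Obj C.
        compose D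
          (Fm (tensor_obj C (tensor_obj C X Y) Z) (tensor_obj C X (tensor_obj C Y Z))
             (associator C X Y Z))
          (compose D (J (tensor_obj C X Y) Z) (tensor_hom D (J X Y) (ident D (F Z)))) =
        compose D (J X (tensor_obj C Y Z))
          (compose D (tensor_hom D (ident D (F X)) (J Y Z))
             (associator D (F X) (F Y) (F Z)))) \<and>
     (\<forall>X\<in>Obj C. left_unitor D (F X) =
        compose D (Fm (tensor_obj C (unit_obj C) X) X (left_unitor C X))
          (compose D (J (unit_obj C) X) (tensor_hom D j (ident D (F X))))) \<and>
     (\<forall>X\<in>Obj C. right_unitor D (F X) =
        compose D (Fm (tensor_obj C X (unit_obj C)) X (right_unitor C X))
          (compose D (J X (unit_obj C)) (tensor_hom D (ident D (F X)) j)))"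

definition tensor_equivalent ::
  "('o, 'm, 'k) tensor_category \<Rightarrow> ('p, 'n, 'k) tensor_category \<Rightarrow> bool" where
  "tensor_equivalent C D \<longleftrightarrow>
     (\<exists>F Fm J j. linear_equivalence C D F Fm \<and> tensor_structure C D F Fm J j)"

text \<open>
  A finite-dimensional left module is given in coordinates: \<open>(d, \<rho>)\<close> stands for the space of column
  vectors of length \<open>d\<close> on which \<open>a\<close> acts by the matrix \<open>\<rho> a\<close>. Every finite-dimensional left module is
  isomorphic to one of this form, so these modules form a full tensor subcategory equivalent to the
  category of all finite-dimensional left modules. The Kronecker product realises the tensor
  product of the spaces of lengths \<open>m\<close> and \<open>n\<close> on the one of length \<open>m * n\<close>. It is strictly associative
  and unital, hence the associators and unitors are identity matrices.
\<close>

definition kronecker :: "'k::semiring_0 mat \<Rightarrow> 'k mat \<Rightarrow> 'k mat" where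
  "kronecker M N = mat (dim_row M * dim_row N) (dim_col M * dim_col N)
     (\<lambda>(i, j). M $$ (i div dim_row N, j div dim_col N) * N $$ (i mod dim_row N, j mod dim_col N))"

definition fd_modules ::
  "('k::field \<Rightarrow> 'a::ring_1 \<Rightarrow> 'a) \<Rightarrow> (nat \<times> ('a \<Rightarrow> 'k mat)) set" where
  "fd_modules scale = {(d, \<rho>).
     (\<forall>a. \<rho> a \<in> carrier_mat d d) \<and> \<rho> 1 = 1\<^sub>m d \<and>
     (\<forall>a b. \<rho> (a * b) = \<rho> a * \<rho> b) \<and> (\<forall>a b. \<rho> (a + b) = \<rho> a + \<rho> b) \<and>
     (\<forall>c a. \<rho> (scale c a) = c \<cdot>\<^sub>m \<rho> a)}"

definition module_homs ::
  "nat \<times> ('a \<Rightarrow> 'k::field mat) \<Rightarrow> nat \<times> ('a \<Rightarrow> 'k mat) \<Rightarrow> 'k mat set" where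
  "module_homs V W =
     {M \<in> carrier_mat (fst W) (fst V). \<forall>a. M * snd V a = snd W a * M}"

definition module_tensor ::
  "('a \<Rightarrow> ('a \<times> 'a) list) \<Rightarrow> nat \<times> ('a \<Rightarrow> 'k::field mat) \<Rightarrow> nat \<times> ('a \<Rightarrow> 'k mat)
    \<Rightarrow> nat \<times> ('a \<Rightarrow> 'k mat)" where
  "module_tensor \<Delta> V W = (fst V * fst W,
     (\<lambda>a. mat (fst V * fst W) (fst V * fst W)
        (\<lambda>ij. \<Sum>(x, y)\<leftarrow>\<Delta> a. kronecker (snd V x) (snd W y) $$ ij)))"

definition rep_category ::
  "('k::field \<Rightarrow> 'a::ring_1 \<Rightarrow> 'a) \<Rightarrow> ('a \<Rightarrow> ('a \<times> 'a) list) \<Rightarrow> ('a \<Rightarrow> 'k)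
    \<Rightarrow> (nat \<times> ('a \<Rightarrow> 'k mat), 'k mat, 'k) tensor_category" where
  "rep_category scale \<Delta> \<epsilon> = \<lparr>
     Obj = fd_modules scale,
     Hom = module_homs,
     compose = (*),
     ident = (\<lambda>V. 1\<^sub>m (fst V)),
     hom_add = (+),
     hom_scale = (\<cdot>\<^sub>m),
     tensor_obj = module_tensor \<Delta>,
     tensor_hom = kronecker,
     unit_obj = (1, \<lambda>a. \<epsilon> a \<cdot>\<^sub>m 1\<^sub>m 1),
     associator = (\<lambda>U V W. 1\<^sub>m (fst U * fst V * fst W)),
     left_unitor = (\<lambda>V. 1\<^sub>m (fst V)),
     right_unitor = (\<lambda>V. 1\<^sub>m (fst V))\<rparr>"

definition gauge_equivalent ::
  "('k::field \<Rightarrow> 'a::ring_1 \<Rightarrow> 'a) \<Rightarrow> ('a \<Rightarrow> ('a \<times> 'a) list) \<Rightarrow> ('a \<Rightarrow> 'k)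
    \<Rightarrow> ('k \<Rightarrow> 'b::ring_1 \<Rightarrow> 'b) \<Rightarrow> ('b \<Rightarrow> ('b \<times> 'b) list) \<Rightarrow> ('b \<Rightarrow> 'k) \<Rightarrow> bool" where
  "gauge_equivalent scale \<Delta> \<epsilon> scale' \<Delta>' \<epsilon>' \<longleftrightarrow>
     tensor_equivalent (rep_category scale \<Delta> \<epsilon>) (rep_category scale' \<Delta>' \<epsilon>')"

end

theory Submission
  imports Defs
begin

text \<open>
  Let \<open>W\<close> be the \<open>n\<close>-th tensor power of a module \<open>V\<close>. The integral acts on \<open>W\<close> as an idempotent \<open>P\<close>
  that factors through the trivial module: \<open>P = \<Sum> u\<^sub>i \<circ> w\<^sub>i\<close> with \<open>w\<^sub>i : W \<rightarrow> 1\<close> and \<open>u\<^sub>i : 1 \<rightarrow> W\<close>. Feeding the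
  output of each leg of \<open>P\<close> into the input of the preceding leg gives
  \<open>\<Lambda>\<^sub>(\<^sub>1\<^sub>) \<dots> \<Lambda>\<^sub>(\<^sub>n\<^sub>) = \<Sum> (id\<^sub>V \<otimes> w\<^sub>i) \<circ> (u\<^sub>i \<otimes> id\<^sub>V)\<close> on \<open>V\<close>, because \<open>W \<otimes> V = V \<otimes> W\<close>, and similarly
  \<open>\<Lambda>\<^sub>(\<^sub>n\<^sub>) \<dots> \<Lambda>\<^sub>(\<^sub>1\<^sub>) = \<Sum> (w\<^sub>i \<otimes> id\<^sub>V) \<circ> (id\<^sub>V \<otimes> u\<^sub>i)\<close>. As \<open>S\<close> fixes \<open>\<Lambda>\<close> and reverses products and
  coproducts, the latter is \<open>P\<^sub>-\<^sub>n(\<Lambda>)\<close>. These formulas use the tensor structure only, and a tensor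
  equivalence \<open>F\<close> maps the action of \<open>\<Lambda>\<close> on \<open>W\<close> to that of \<open>\<Lambda>'\<close> on \<open>F W\<close>; so it maps the action of
  \<open>P\<^sub>n(\<Lambda>)\<close> on \<open>V\<close> to that of \<open>P'\<^sub>n(\<Lambda>')\<close> on \<open>F V\<close>. This persists for polynomials in these elements, and
  faithful modules detect their vanishing.
\<close>

section \<open>Sweedler sums and the antipode\<close>

lemma sum_list_concat_map: "sum_list (map g (concat (map h xs))) = (\<Sum>x\<leftarrow>xs. sum_list (map g (h x)))"
  by (induction xs) auto

text \<open>This is the universal property of the tensor power: each generator of the congruence is
  respected by a map that is additive in each slot and lets scalars move between slots. The target
  is only an abelian group, so balancedness takes the place of linearity; additivity alone makes a
  tuple with a zero entry vanish.\<close>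

lemma tensor_eq_sum_list:
  fixes \<Phi> :: "'a::ring_1 list \<Rightarrow> 'm::ab_group_add"
  assumes "tensor_eq scale s t"
    and add: "\<And>us x y vs. \<Phi> (us @ (x + y) # vs) = \<Phi> (us @ x # vs) + \<Phi> (us @ y # vs)"
    and bal: "\<And>c us x vs y ws. \<Phi> (us @ scale c x # vs @ y # ws) = \<Phi> (us @ x # vs @ scale c y # ws)"
  shows "(\<Sum>l\<leftarrow>s. \<Phi> l) = (\<Sum>l\<leftarrow>t. \<Phi> l)"
  using assms(1)
proof induction
  case (zero us vs)
  have "\<Phi> (us @ 0 # vs) = 0"
    using add[of us 0 0 vs] by simp
  then show ?case by simp
next
  case (reorder s t)
  then have "image_mset \<Phi> (mset s) = image_mset \<Phi> (mset t)" by simp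
  then show ?case by (metis mset_map sum_mset_sum_list)
qed (simp_all add: add bal)

context fd_algebra
begin

definition bilin :: "('a \<Rightarrow> 'a \<Rightarrow> 'm::ab_group_add) \<Rightarrow> bool" where
  "bilin f \<longleftrightarrow> (\<forall>x x' y. f (x + x') y = f x y + f x' y) \<and>
     (\<forall>x y y'. f x (y + y') = f x y + f x y') \<and>
     (\<forall>c x y. f (scale c x) y = f x (scale c y))"

text \<open>Moving a scalar between the outer slots is the composite of the two adjacent moves, so
  only the adjacent ones are listed.\<close>

definition trilin :: "('a \<Rightarrow> 'a \<Rightarrow> 'a \<Rightarrow> 'm::ab_group_add) \<Rightarrow> bool" where
  "trilin f \<longleftrightarrow> (\<forall>x x' y z. f (x + x') y z = f x y z + f x' y z) \<and>
     (\<forall>x y y' z. f x (y + y') z = f x y z + f x y' z) \<and>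
     (\<forall>x y z z'. f x y (z + z') = f x y z + f x y z') \<and>
     (\<forall>c x y z. f (scale c x) y z = f x (scale c y) z) \<and>
     (\<forall>c x y z. f x (scale c y) z = f x y (scale c z))"

text \<open>The congruence lives on lists of all lengths, so \<open>f\<close> is extended by 0 to
  lists of length other than 2. The rules of the congruence compare only lists of equal length up to
  zero tensors, and the constant 0 is additive and balanced, so the universal property applies to
  the extension.\<close>

lemma tensor_eq_bilin:
  assumes "tensor_eq scale s t" and f: "bilin f"
  shows "(\<Sum>l\<leftarrow>s. case l of [x, y] \<Rightarrow> f x y | _ \<Rightarrow> 0) = (\<Sum>l\<leftarrow>t. case l of [x, y] \<Rightarrow> f x y | _ \<Rightarrow> 0)"
  using assms(1)
proof (rule tensor_eq_sum_list)
  show "(case us @ (x + y) # vs of [x, y] \<Rightarrow> f x y | _ \<Rightarrow> 0) =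
    (case us @ x # vs of [x, y] \<Rightarrow> f x y | _ \<Rightarrow> 0) + (case us @ y # vs of [x, y] \<Rightarrow> f x y | _ \<Rightarrow> 0)"
    for us x y vs
    using f by (cases us; cases "tl us"; cases vs) (auto simp: bilin_def split: list.splits)
  show "(case us @ scale c x # vs @ y # ws of [x, y] \<Rightarrow> f x y | _ \<Rightarrow> 0) =
    (case us @ x # vs @ scale c y # ws of [x, y] \<Rightarrow> f x y | _ \<Rightarrow> 0)" for c us x vs y ws
    using f by (cases us; cases vs; cases ws) (auto simp: bilin_def split: list.splits)
qed

lemma tensor_eq_trilin:
  assumes "tensor_eq scale s t" and f: "trilin f"
  shows "(\<Sum>l\<leftarrow>s. case l of [x, y, z] \<Rightarrow> f x y z | _ \<Rightarrow> 0) =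
    (\<Sum>l\<leftarrow>t. case l of [x, y, z] \<Rightarrow> f x y z | _ \<Rightarrow> 0)"
  using assms(1)
proof (rule tensor_eq_sum_list)
  show "(case us @ (x + y) # vs of [x, y, z] \<Rightarrow> f x y z | _ \<Rightarrow> 0) =
    (case us @ x # vs of [x, y, z] \<Rightarrow> f x y z | _ \<Rightarrow> 0) +
    (case us @ y # vs of [x, y, z] \<Rightarrow> f x y z | _ \<Rightarrow> 0)"
    for us x y vs
    using f by (cases us; cases "tl us"; cases "tl (tl us)"; cases vs; cases "tl vs")
      (auto simp: trilin_def split: list.splits)
  show "(case us @ scale c x # vs @ y # ws of [x, y, z] \<Rightarrow> f x y z | _ \<Rightarrow> 0) =
    (case us @ x # vs @ scale c y # ws of [x, y, z] \<Rightarrow> f x y z | _ \<Rightarrow> 0)" for c us x vs y ws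
    using f by (cases us; cases vs; cases ws; cases "tl us"; cases "tl vs"; cases "tl ws")
      (auto simp: trilin_def split: list.splits)
qed

end

section \<open>Sweedler notation\<close>

context hopf_algebra
begin

text \<open>\<open>sw a f\<close> is Sweedler's f(a_1, a_2), as a binder that can be nested. It
  refers to the chosen representative of \<Delta> a; only for \<open>bilin f\<close> does it depend
  on the class in the tensor square alone.\<close>

definition sw :: "'a \<Rightarrow> ('a \<Rightarrow> 'a \<Rightarrow> 'm::ab_group_add) \<Rightarrow> 'm" where
  "sw a f = (\<Sum>(x, y)\<leftarrow>\<Delta> a. f x y)"

lemma sw_comult_add: "bilin f \<Longrightarrow> sw (a + b) f = sw a f + sw b f"
  using tensor_eq_bilin[OF comult_add, of f a b]
  by (simp add: sw_def o_def case_prod_unfold)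

text \<open>The scalar stays inside the first slot because the target of \<open>f\<close> carries no
  scalar action.\<close>

lemma sw_comult_scale: "bilin f \<Longrightarrow> sw (scale c a) f = sw a (\<lambda>x y. f (scale c x) y)"
  using tensor_eq_bilin[OF comult_scale, of f c a]
  by (simp add: sw_def o_def case_prod_unfold)

lemma sw_comult_mult:
  "bilin f \<Longrightarrow> sw (a * b) f = sw a (\<lambda>x y. sw b (\<lambda>x' y'. f (x * x') (y * y')))"
  using tensor_eq_bilin[OF comult_mult, of f a b]
  by (simp add: sw_def o_def case_prod_unfold sum_list_concat_map)

lemma sw_comult_one: "bilin f \<Longrightarrow> sw 1 f = f 1 1"
  using tensor_eq_bilin[OF comult_one, of f]
  by (simp add: sw_def o_def case_prod_unfold)

lemma sw_coassoc:
  "trilin f \<Longrightarrow> sw a (\<lambda>u z. sw u (\<lambda>x y. f x y z)) = sw a (\<lambda>x u. sw u (\<lambda>y z. f x y z))"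
  using tensor_eq_trilin[OF coassoc, of f a]
  by (simp add: sw_def o_def case_prod_unfold sum_list_concat_map)

lemma sw_add: "sw a (\<lambda>x y. f x y + g x y) = sw a f + sw a g"
  by (simp add: sw_def case_prod_unfold sum_list_addf)

lemma sw_hom:
  assumes "\<And>x y. h (x + y) = h x + h y"
  shows "sw a (\<lambda>x y. h (f x y)) = h (sw a f)"
proof -
  have "h 0 = 0" using assms[of 0 0] by simp
  then have "(\<Sum>(x, y)\<leftarrow>l. h (f x y)) = h (\<Sum>(x, y)\<leftarrow>l. f x y)" for l
    by (induction l) (auto simp: assms)
  then show ?thesis by (simp add: sw_def)
qed

lemma sw_swap:
  fixes f :: "_ \<Rightarrow> _ \<Rightarrow> _ \<Rightarrow> _ \<Rightarrow> 'b::ab_group_add"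
  shows "sw a (\<lambda>x y. sw b (\<lambda>u v. f x y u v)) = sw b (\<lambda>u v. sw a (\<lambda>x y. f x y u v))"
proof -
  have "(\<Sum>p\<leftarrow>l. \<Sum>q\<leftarrow>l'. g p q) = (\<Sum>q\<leftarrow>l'. \<Sum>p\<leftarrow>l. g p q)" for l l' and g :: "_ \<Rightarrow> _ \<Rightarrow> 'b"
    by (induction l) (simp_all add: sum_list_addf)
  then show ?thesis by (simp add: sw_def case_prod_unfold)
qed

lemma sw_scale: "sw a (\<lambda>x y. scale c (f x y)) = scale c (sw a f)"
  by (rule sw_hom) (rule scale_right_distrib)

lemma sw_mult_left: "sw a (\<lambda>x y. b * f x y) = b * sw a f" for b :: "'m::ring"
  by (rule sw_hom) (rule distrib_left)

lemma sw_mult_right: "sw a (\<lambda>x y. f x y * b) = sw a f * b" for b :: "'m::ring"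
  by (rule sw_hom[of "\<lambda>x. x * b"]) (rule distrib_right)

definition lin :: "('a \<Rightarrow> 'a) \<Rightarrow> bool" where
  "lin f \<longleftrightarrow> (\<forall>x y. f (x + y) = f x + f y) \<and> (\<forall>c x. f (scale c x) = scale c (f x))"

lemma sw_counit_left: "lin f \<Longrightarrow> sw a (\<lambda>x y. scale (\<epsilon> x) (f y)) = f a"
  using sw_hom[of f a "\<lambda>x y. scale (\<epsilon> x) y"] counit_left[of a]
  by (simp add: lin_def sw_def)

lemma sw_counit_right: "lin f \<Longrightarrow> sw a (\<lambda>x y. scale (\<epsilon> y) (f x)) = f a"
  using sw_hom[of f a "\<lambda>x y. scale (\<epsilon> y) x"] counit_right[of a]
  by (simp add: lin_def sw_def)

lemma sw_antipode_left: "sw a (\<lambda>x y. S x * y) = scale (\<epsilon> a) 1"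
  using antipode_left by (simp add: sw_def)

lemma sw_antipode_right: "sw a (\<lambda>x y. x * S y) = scale (\<epsilon> a) 1"
  using antipode_right by (simp add: sw_def)

section \<open>The antipode reverses products and coproducts\<close>

lemmas lin_simps = bilin_def trilin_def lin_def distrib_left distrib_right scale_mult_left
  scale_mult_right antipode_add antipode_scale counit_add counit_scale counit_mult
  scale_right_distrib scale_left_distrib sw_add sw_scale mult.assoc

text \<open>Among maps of (a, b) under convolution, S(a b) is a left inverse and S(b) S(a) a right
  inverse of the multiplication. Hence the triple convolution S(a_1 b_1) a_2 b_2 S(b_3) S(a_3)
  equals both of them.\<close>

lemma antipode_mult: "S (a * b) = S b * S a"
proof -
  \<comment> \<open>\<open>G\<close> is the convolution of the multiplication with S(b) S(a). The
    inner factor y S(y') collapses first, then x S(x').\<close>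
  define G where "G a b = sw a (\<lambda>x x'. sw b (\<lambda>y y'. x * (y * (S y' * S x'))))" for a b
  have G: "G a b = scale (\<epsilon> a * \<epsilon> b) 1" for a b
  proof -
    have "sw b (\<lambda>y y'. x * (y * (S y' * S x'))) = scale (\<epsilon> b) (x * S x')" for x x'
      using sw_mult_left[of b x "\<lambda>y y'. (y * S y') * S x'"]
        sw_mult_right[of b "\<lambda>y y'. y * S y'" "S x'"] sw_antipode_right[of b]
      by (simp add: mult.assoc scale_mult_left scale_mult_right)
    then show ?thesis
      by (simp add: G_def sw_scale sw_antipode_right mult.commute)
  qed
  have "sw a (\<lambda>a1 a2. sw b (\<lambda>b1 b2. S (a1 * b1) * G a2 b2)) =
    sw a (\<lambda>a1 a2. scale (\<epsilon> a2) (S (a1 * b)))"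
  proof -
    have "sw b (\<lambda>b1 b2. S (a1 * b1) * G a2 b2) = scale (\<epsilon> a2) (S (a1 * b))" for a1 a2
      using sw_counit_right[of "\<lambda>b1. S (a1 * b1)" b]
      by (simp add: G scale_mult_right sw_scale lin_simps flip: scale_scale)
    then show ?thesis by simp
  qed
  also have "\<dots> = S (a * b)"
    by (rule sw_counit_right) (simp add: lin_simps)
  finally have 1: "sw a (\<lambda>a1 a2. sw b (\<lambda>b1 b2. S (a1 * b1) * G a2 b2)) = S (a * b)" .
  \<comment> \<open>Second evaluation: coassociativity in \<open>b\<close> and then in
    \<open>a\<close> groups the first two legs of each together.\<close>
  have "sw a (\<lambda>a1 a2. sw b (\<lambda>b1 b2. S (a1 * b1) * G a2 b2)) =
    sw a (\<lambda>a1 a2. sw a2 (\<lambda>x x'. sw b (\<lambda>b1 b2. sw b2 (\<lambda>y y'.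
      S (a1 * b1) * (x * (y * (S y' * S x')))))))"
    unfolding G_def sw_mult_left[symmetric]
    by (subst sw_swap) (rule refl)
  also have "\<dots> = sw a (\<lambda>a1 a2. sw a2 (\<lambda>x x'. sw b (\<lambda>v y'. sw v (\<lambda>b1 y.
      S (a1 * b1) * (x * (y * (S y' * S x')))))))"
    by (subst sw_coassoc) (simp_all add: lin_simps)
  also have "\<dots> = sw a (\<lambda>u x'. sw u (\<lambda>a1 x. sw b (\<lambda>v y'. sw v (\<lambda>b1 y.
      S (a1 * b1) * (x * (y * (S y' * S x')))))))"
    by (subst sw_coassoc) (simp_all add: lin_simps)
  also have "\<dots> = sw a (\<lambda>u x'. sw b (\<lambda>v y'. sw u (\<lambda>a1 x. sw v (\<lambda>b1 y.
      (S (a1 * b1) * (x * y)) * (S y' * S x')))))"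
    by (subst sw_swap) (simp add: mult.assoc)
  \<comment> \<open>The pairs of products of the legs of \<open>u\<close> and \<open>v\<close>
    represent the coproduct of \<open>u * v\<close>, so the left antipode axiom for
    \<open>u * v\<close> applies.\<close>
  also have "\<dots> = sw a (\<lambda>u x'. sw b (\<lambda>v y'. sw (u * v) (\<lambda>p q. S p * q) * (S y' * S x')))"
    by (subst sw_comult_mult) (simp add: lin_simps, simp only: sw_mult_right)
  also have "\<dots> = sw a (\<lambda>u x'. sw b (\<lambda>v y'. scale (\<epsilon> u) (scale (\<epsilon> v) (S y' * S x'))))"
    by (simp add: sw_antipode_left counit_mult scale_mult_left)
  also have "\<dots> = sw a (\<lambda>u x'. scale (\<epsilon> u) (S b * S x'))"
    using sw_counit_left[of "\<lambda>y. S y * S x'" b for x'] by (simp add: sw_scale lin_simps del: scale_scale)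
  also have "\<dots> = S b * S a"
    by (rule sw_counit_left) (simp add: lin_simps)
  finally show ?thesis using 1 by simp
qed

text \<open>Apply \<epsilon> to the left antipode axiom; multiplicativity of \<epsilon> turns the
  second leg into a scalar, which the counit axiom absorbs under S.\<close>

lemma counit_antipode: "\<epsilon> (S a) = \<epsilon> a"
proof -
  have h: "\<epsilon> (x + y) = \<epsilon> x + \<epsilon> y" for x y by (rule counit_add)
  have "\<epsilon> a = \<epsilon> (sw a (\<lambda>x y. S x * y))"
    by (simp add: sw_antipode_left counit_scale counit_one)
  also have "\<dots> = \<epsilon> (S (sw a (\<lambda>x y. scale (\<epsilon> y) x)))"
    by (simp add: sw_hom[symmetric, of \<epsilon>] sw_hom[symmetric, of S] lin_simps mult.commute)
  also have "sw a (\<lambda>x y. scale (\<epsilon> y) x) = a"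
    by (rule sw_counit_right) (simp add: lin_simps)
  finally show ?thesis by simp
qed

text \<open>In four legs this reads u_1 S(u_4) \<otimes> u_2 S(u_3) = \<epsilon>(u) 1 \<otimes> 1,
  evaluated through \<open>g\<close>. The inner pair u_2, u_3 cancels first and then the outer one.
  It shows that S(w_2) \<otimes> S(w_1) is a right convolution inverse of \<Delta>.\<close>

lemma sw_antipode_cancel:
  assumes g1: "\<And>x. lin (g x)" and g2: "\<And>y. lin (\<lambda>x. g x y)"
  shows "sw u (\<lambda>v w. sw v (\<lambda>x y. sw w (\<lambda>p q. g (x * S q) (y * S p)))) = scale (\<epsilon> u) (g 1 1)"
proof -
  note ls = lin_simps g1[unfolded lin_def] g2[unfolded lin_def]
  have "sw u (\<lambda>v w. sw v (\<lambda>x y. sw w (\<lambda>p q. g (x * S q) (y * S p)))) =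
    sw u (\<lambda>x v. sw v (\<lambda>y w. sw w (\<lambda>p q. g (x * S q) (y * S p))))"
    by (rule sw_coassoc) (simp add: ls sw_comult_add sw_comult_scale)
  also have "\<dots> = sw u (\<lambda>x v. sw v (\<lambda>r q. sw r (\<lambda>y p. g (x * S q) (y * S p))))"
    by (subst sw_coassoc) (simp_all add: ls)
  also have "\<dots> = sw u (\<lambda>x v. sw v (\<lambda>r q. scale (\<epsilon> r) (g (x * S q) 1)))"
    by (subst sw_hom) (simp_all add: ls sw_antipode_right)
  also have "\<dots> = sw u (\<lambda>x v. g (x * S v) 1)"
    by (subst sw_counit_left) (simp_all add: ls)
  also have "\<dots> = scale (\<epsilon> u) (g 1 1)"
    by (subst sw_hom[where h = "\<lambda>x. g x 1"]) (simp_all add: ls sw_antipode_right)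
  finally show ?thesis .
qed

text \<open>Uniqueness of convolution inverses again, now for maps into the tensor square:
  \<Delta>(S(a)) is a left inverse of \<Delta> and S(a_2) \<otimes> S(a_1) a right inverse. All is
  evaluated through a bilinear \<open>f\<close> with values in the algebra.\<close>

lemma comult_antipode:
  assumes f1: "\<And>x. lin (f x)" and f2: "\<And>y. lin (\<lambda>x. f x y)"
  shows "sw (S a) f = sw a (\<lambda>x y. f (S y) (S x))"
proof -
  note ls = lin_simps f1[unfolded lin_def] f2[unfolded lin_def]
  \<comment> \<open>\<open>T u v w\<close> is the image under \<open>f\<close> of \<Delta>(S(u))
    \<Delta>(v) (S(w_2) \<otimes> S(w_1)).\<close>
  define T where "T u v w = sw (S u) (\<lambda>s t. sw v (\<lambda>x y. sw w (\<lambda>p q.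
    f (s * (x * S q)) (t * (y * S p)))))" for u v w
  have T: "trilin T"
    unfolding T_def by (simp add: ls sw_comult_add sw_comult_scale)
  have "sw u (\<lambda>v w. T b v w) = scale (\<epsilon> u) (sw (S b) f)" for b u
  proof -
    have "sw u (\<lambda>v w. T b v w) = sw (S b) (\<lambda>s t. sw u (\<lambda>v w. sw v (\<lambda>x y. sw w (\<lambda>p q.
      f (s * (x * S q)) (t * (y * S p))))))"
      unfolding T_def by (rule sw_swap)
    also have "\<dots> = sw (S b) (\<lambda>s t. scale (\<epsilon> u) (f s t))"
      by (subst sw_antipode_cancel[where g = "\<lambda>x y. f (s * x) (t * y)" for s t]) (simp_all add: ls)
    finally show ?thesis by (simp add: sw_scale)
  qed
  then have "sw a (\<lambda>b u. sw u (\<lambda>v w. T b v w)) = sw a (\<lambda>b u. scale (\<epsilon> u) (sw (S b) f))"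
    by simp
  also have "\<dots> = sw (S a) f"
    by (rule sw_counit_right) (simp add: ls sw_comult_add sw_comult_scale)
  finally have 1: "sw a (\<lambda>b u. sw u (\<lambda>v w. T b v w)) = sw (S a) f" .
  \<comment> \<open>The first two factors of \<open>T\<close> combine to \<Delta>(S(v) w), so the
    left antipode axiom cancels them.\<close>
  have "sw u (\<lambda>v w. T v w z) = scale (\<epsilon> u) (sw z (\<lambda>x y. f (S y) (S x)))" for u z
  proof -
    define h where "h r = sw r (\<lambda>s t. sw z (\<lambda>p q. f (s * S q) (t * S p)))" for r
    have "T v w z = h (S v * w)" for v w
      unfolding T_def h_def by (subst sw_comult_mult) (simp_all add: ls)
    moreover have "sw u (\<lambda>v w. h (S v * w)) = h (scale (\<epsilon> u) 1)"
      unfolding sw_antipode_left[symmetric]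
      by (rule sw_hom) (simp add: h_def ls sw_comult_add)
    moreover have "h (scale (\<epsilon> u) 1) = scale (\<epsilon> u) (sw z (\<lambda>x y. f (S y) (S x)))"
      unfolding h_def by (simp add: ls sw_comult_scale sw_comult_one)
    ultimately show ?thesis by simp
  qed
  then have "sw a (\<lambda>u z. sw u (\<lambda>v w. T v w z)) = sw a (\<lambda>u z. scale (\<epsilon> u) (sw z (\<lambda>x y. f (S y) (S x))))"
    by simp
  also have "\<dots> = sw a (\<lambda>x y. f (S y) (S x))"
    by (rule sw_counit_left) (simp add: ls sw_comult_add sw_comult_scale)
  finally show ?thesis using 1 sw_coassoc[OF T, of a] by simp
qed

text \<open>
  Since \<open>S\<close> reverses products, \<open>S \<Lambda>\<close> is a right integral; both have counit 1, so \<open>S \<Lambda> = S \<Lambda> * \<Lambda> = \<Lambda>\<close>.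
\<close>

lemma antipode_integral:
  assumes \<Lambda>: "is_left_integral scale \<epsilon> \<Lambda>" and "\<epsilon> \<Lambda> = 1"
  shows "S \<Lambda> = \<Lambda>" and "\<Lambda> * a = scale (\<epsilon> a) \<Lambda>"
proof -
  have SS: "S \<Lambda> * S b = scale (\<epsilon> b) (S \<Lambda>)" for b
    using \<Lambda> by (metis antipode_mult antipode_scale is_left_integral_def)
  \<comment> \<open>To replace S(b) by b without appealing to surjectivity of S, the scalar
    \<epsilon>(b) is expanded as S(b_1) b_2 next to S(\<Lambda>); the first leg is then absorbed by
    \<open>SS\<close>.\<close>
  have R: "S \<Lambda> * b = scale (\<epsilon> b) (S \<Lambda>)" for b
  proof -
    have "scale (\<epsilon> b) (S \<Lambda>) = S \<Lambda> * sw b (\<lambda>x y. S x * y)"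
      by (simp add: sw_antipode_left scale_mult_right)
    also have "\<dots> = sw b (\<lambda>x y. scale (\<epsilon> x) (S \<Lambda> * y))"
      by (simp add: sw_mult_left[symmetric] mult.assoc[symmetric] SS scale_mult_left)
    also have "\<dots> = S \<Lambda> * b"
      by (rule sw_counit_left) (simp add: lin_simps)
    finally show ?thesis by simp
  qed
  have "S \<Lambda> * \<Lambda> = S \<Lambda>" using R[of \<Lambda>] \<open>\<epsilon> \<Lambda> = 1\<close> by simp
  moreover have "S \<Lambda> * \<Lambda> = \<Lambda>"
    using \<Lambda> \<open>\<epsilon> \<Lambda> = 1\<close> by (simp add: is_left_integral_def counit_antipode)
  ultimately show *: "S \<Lambda> = \<Lambda>" by simp
  show "\<Lambda> * a = scale (\<epsilon> a) \<Lambda>" using R[of a] * by simp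
qed

text \<open>\<Lambda> = \<Lambda> \<Lambda> = \<epsilon>(\<Lambda>) \<Lambda>, and a nonzero vector
  can be cancelled.\<close>

lemma counit_idempotent_integral:
  assumes "is_left_integral scale \<epsilon> \<Lambda>" "\<Lambda> * \<Lambda> = \<Lambda>" "\<Lambda> \<noteq> 0"
  shows "\<epsilon> \<Lambda> = 1"
  using assms scale_right_imp_eq[of \<Lambda> "\<epsilon> \<Lambda>" 1] by (simp add: is_left_integral_def)

section \<open>Sweedler powers as nested Sweedler sums\<close>

primrec power_sum :: "nat \<Rightarrow> 'a \<Rightarrow> 'a" where
  "power_sum 0 a = a"
| "power_sum (Suc m) a = sw a (\<lambda>x y. x * power_sum m y)"

primrec rev_power_sum :: "nat \<Rightarrow> 'a \<Rightarrow> 'a" where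
  "rev_power_sum 0 a = a"
| "rev_power_sum (Suc m) a = sw a (\<lambda>x y. rev_power_sum m y * x)"

lemma power_sum_iterated_comult: "(\<Sum>t\<leftarrow>iterated_comult \<Delta> m a. prod_list t) = power_sum m a"
proof (induction m arbitrary: a)
  case (Suc m)
  have "(\<Sum>t\<leftarrow>iterated_comult \<Delta> m y. x * prod_list t) = x * power_sum m y" for x y
    by (simp add: Suc.IH[symmetric] sum_list_const_mult)
  then show ?case by (simp add: sw_def case_prod_unfold sum_list_concat_map o_def)
qed simp

lemma rev_power_sum_iterated_comult:
  "(\<Sum>t\<leftarrow>iterated_comult \<Delta> m a. prod_list (rev t)) = rev_power_sum m a"
proof (induction m arbitrary: a)
  case (Suc m)
  have "(\<Sum>t\<leftarrow>iterated_comult \<Delta> m y. prod_list (rev t) * x) = rev_power_sum m y * x" for x y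
    by (simp add: Suc.IH[symmetric] sum_list_mult_const)
  then show ?case by (simp add: sw_def case_prod_unfold sum_list_concat_map o_def)
qed simp

lemma lin_rev_power_sum: "lin (rev_power_sum m)"
  by (induction m) (simp_all add: lin_simps sw_comult_add sw_comult_scale)

text \<open>Coassociativity allows the last leg to be split off instead of the first. This recursion
  is the one that meets the coproduct of S(a), whose legs come in reversed order.\<close>

lemma rev_power_sum_Suc: "rev_power_sum (Suc m) a = sw a (\<lambda>x y. y * rev_power_sum m x)"
proof (induction m arbitrary: a)
  case (Suc m)
  note ls = lin_rev_power_sum[of m, unfolded lin_def] lin_simps
  have "sw a (\<lambda>x y. y * rev_power_sum (Suc m) x) =
    sw a (\<lambda>u z. sw u (\<lambda>x y. z * (rev_power_sum m y * x)))"
    by (simp add: sw_mult_left)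
  also have "\<dots> = sw a (\<lambda>x u. sw u (\<lambda>y z. z * (rev_power_sum m y * x)))"
    by (rule sw_coassoc) (simp add: ls)
  also have "\<dots> = sw a (\<lambda>x u. sw u (\<lambda>y z. z * rev_power_sum m y) * x)"
    by (simp add: sw_mult_right[symmetric] mult.assoc)
  also have "\<dots> = sw a (\<lambda>x u. rev_power_sum (Suc m) u * x)"
    by (simp only: Suc.IH)
  finally show ?case by simp
qed simp

text \<open>S reverses the factors and also the legs of the coproduct; the two reversals cancel, so
  the decreasing order is kept.\<close>

lemma antipode_rev_power_sum: "S (rev_power_sum m a) = rev_power_sum m (S a)"
proof (induction m arbitrary: a)
  case (Suc m)
  note ls = lin_rev_power_sum[of m, unfolded lin_def] lin_simps
  have "S (rev_power_sum (Suc m) a) = sw a (\<lambda>x y. S x * rev_power_sum m (S y))"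
    by (simp add: sw_hom[of S, symmetric] antipode_add antipode_mult Suc.IH)
  also have "\<dots> = sw (S a) (\<lambda>x y. y * rev_power_sum m x)"
    by (rule comult_antipode[symmetric]) (simp_all add: ls)
  finally show ?case by (simp only: rev_power_sum_Suc)
qed simp

text \<open>For negative \<open>n\<close> the outer antipode passes inside and is absorbed by
  S(\<Lambda>) = \<Lambda>. The index of \<open>power_sum\<close> and \<open>rev_power_sum\<close>
  counts comultiplications, hence is one less than the number of factors.\<close>

lemma sweedler_power_integral:
  assumes \<Lambda>: "is_left_integral scale \<epsilon> \<Lambda>" "\<epsilon> \<Lambda> = 1"
  shows "sweedler_power scale \<Delta> \<epsilon> S n \<Lambda> =
    (if n \<ge> 1 then power_sum (nat n - 1) \<Lambda> else if n = 0 then 1 else rev_power_sum (nat (- n) - 1) \<Lambda>)"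
  by (simp add: sweedler_power_def power_sum_iterated_comult rev_power_sum_iterated_comult
      antipode_rev_power_sum antipode_integral[OF \<Lambda>] \<Lambda>(2))

end

section \<open>Kronecker products and contractions\<close>

lemma sum_nat_mult:
  fixes f :: "nat \<Rightarrow> 'm::comm_monoid_add"
  shows "(\<Sum>k<n * m. f k) = (\<Sum>i<n. \<Sum>j<m. f (i * m + j))"
proof (cases "m = 0")
  case False
  have "(\<Sum>i<n. \<Sum>j<m. f (i * m + j)) = (\<Sum>i<n. sum f {i * m..<i * m + m})"
    by (intro sum.cong refl sum.reindex_bij_witness[of _ "\<lambda>k. k - i * m" "\<lambda>j. i * m + j" for i]) auto
  then show ?thesis using sum.nat_group[of f m n] by simp
qed simp

lemma mult_add_less: "i < n \<Longrightarrow> j < m \<Longrightarrow> i * m + j < n * (m::nat)"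
  by (metis Suc_leI add.commute add_less_cancel_right le_trans less_le_trans mult.commute mult_Suc mult_le_mono2)

lemma mult_add_div_mod: "j < m \<Longrightarrow> (i * m + j) div m = i" "j < m \<Longrightarrow> (i * m + j) mod m = (j::nat)"
  by auto

lemma kronecker_carrier [simp]:
  "M \<in> carrier_mat r c \<Longrightarrow> N \<in> carrier_mat r' c' \<Longrightarrow> kronecker M N \<in> carrier_mat (r * r') (c * c')"
  by (auto simp: kronecker_def)

lemma kronecker_index:
  "M \<in> carrier_mat r c \<Longrightarrow> N \<in> carrier_mat r' c' \<Longrightarrow> i < r * r' \<Longrightarrow> j < c * c' \<Longrightarrow>
   kronecker M N $$ (i, j) = M $$ (i div r', j div c') * N $$ (i mod r', j mod c')"
  by (auto simp: kronecker_def)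

lemma index_mat_mult:
  "A \<in> carrier_mat r n \<Longrightarrow> B \<in> carrier_mat n c \<Longrightarrow> i < r \<Longrightarrow> j < c \<Longrightarrow>
   (A * B) $$ (i, j) = (\<Sum>k<n. A $$ (i, k) * B $$ (k, j))"
  by (auto simp: scalar_prod_def atLeast0LessThan)

lemma div_less_factor: "(i::nat) < r * r' \<Longrightarrow> i div r' < r"
  by (simp add: less_mult_imp_div_less)

lemma mod_less_factor: "(i::nat) < r * r' \<Longrightarrow> i mod r' < r'"
  by (metis mod_less_divisor mult_0_right neq0_conv not_less_zero)

lemma kronecker_mult:
  fixes A B C D :: "'k::comm_ring_1 mat"
  assumes A: "A \<in> carrier_mat r n" and C: "C \<in> carrier_mat n c"
    and B: "B \<in> carrier_mat r' n'" and D: "D \<in> carrier_mat n' c'"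
  shows "kronecker A B * kronecker C D = kronecker (A * C) (B * D)"
proof (rule eq_matI)
  fix i j assume "i < dim_row (kronecker (A * C) (B * D))" "j < dim_col (kronecker (A * C) (B * D))"
  then have ij: "i < r * r'" "j < c * c'" using assms by (auto simp: kronecker_def)
  have K: "kronecker A B \<in> carrier_mat (r * r') (n * n')" "kronecker C D \<in> carrier_mat (n * n') (c * c')"
    using assms by auto
  have "(kronecker A B * kronecker C D) $$ (i, j) =
    (\<Sum>k<n. \<Sum>l<n'. kronecker A B $$ (i, k * n' + l) * kronecker C D $$ (k * n' + l, j))"
    by (simp add: index_mat_mult[OF K] ij sum_nat_mult)
  also have "\<dots> = (\<Sum>k<n. \<Sum>l<n'. (A $$ (i div r', k) * C $$ (k, j div c')) *
      (B $$ (i mod r', l) * D $$ (l, j mod c')))"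
    by (intro sum.cong refl) (auto simp: kronecker_index[OF A B] kronecker_index[OF C D] ij mult_add_less)
  also have "\<dots> = (A * C) $$ (i div r', j div c') * (B * D) $$ (i mod r', j mod c')"
    using ij by (simp add: index_mat_mult[OF A C] index_mat_mult[OF B D] div_less_factor
        mod_less_factor sum_product)
  also have "\<dots> = kronecker (A * C) (B * D) $$ (i, j)"
    by (simp add: kronecker_index[OF mult_carrier_mat[OF A C] mult_carrier_mat[OF B D]] ij)
  finally show "(kronecker A B * kronecker C D) $$ (i, j) = kronecker (A * C) (B * D) $$ (i, j)" .
qed (use assms in \<open>auto simp: kronecker_def\<close>)

text \<open>Both bracketings read an index as the same three mixed-radix digits, so the two products
  agree as matrices and not merely up to a permutation.\<close>

lemma kronecker_assoc:
  fixes A B C :: "'k::comm_ring_1 mat"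
  shows "kronecker (kronecker A B) C = kronecker A (kronecker B C)"
proof (rule eq_matI)
  fix i j assume ij: "i < dim_row (kronecker A (kronecker B C))" "j < dim_col (kronecker A (kronecker B C))"
  have *: "i div c < a * b \<and> i mod (b * c) < b * c \<and> i div c div b = i div (b * c) \<and>
      i div c mod b = i mod (b * c) div c \<and> i mod (b * c) mod c = i mod c"
    if "i < a * (b * c)" for i a b c :: nat
  proof -
    have "i < a * b * c" using that by (simp add: mult.assoc)
    moreover have "c > 0" using that by (cases c) auto
    ultimately show ?thesis
      using mod_less_factor[OF that] div_mult2_eq[of i c b] mod_mult2_eq[of i c b]
      by (auto simp: div_less_factor mult.commute[of b c])
  qed
  show "kronecker (kronecker A B) C $$ (i, j) = kronecker A (kronecker B C) $$ (i, j)"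
    using ij *[of i "dim_row A" "dim_row B" "dim_row C"] *[of j "dim_col A" "dim_col B" "dim_col C"]
    by (simp add: kronecker_def mult.assoc)
qed (auto simp: kronecker_def mult.assoc)

lemma kronecker_one: "kronecker (1\<^sub>m m) (1\<^sub>m n :: 'k::comm_ring_1 mat) = 1\<^sub>m (m * n)"
proof (rule eq_matI)
  fix i j assume ij: "i < dim_row (1\<^sub>m (m * n))" "j < dim_col (1\<^sub>m (m * n))"
  moreover have "i div n = j div n \<and> i mod n = j mod n \<longleftrightarrow> i = j"
    by (metis div_mult_mod_eq)
  ultimately show "kronecker (1\<^sub>m m) (1\<^sub>m n) $$ (i, j) = (1\<^sub>m (m * n) :: 'k mat) $$ (i, j)"
    by (auto simp: kronecker_def div_less_factor mod_less_factor)
qed (auto simp: kronecker_def)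

text \<open>
  For \<open>M = M\<^sub>0 \<otimes> \<dots> \<otimes> M\<^sub>m\<close> on the \<open>(m + 1)\<close>-st tensor power of \<open>k\<^sup>d\<close> and \<open>e = d ^ m\<close>, \<open>contract d e M\<close> is
  \<open>M\<^sub>0 * \<dots> * M\<^sub>m\<close> and \<open>contract_rev d e M\<close> is \<open>M\<^sub>m * \<dots> * M\<^sub>0\<close>.
\<close>

definition contract :: "nat \<Rightarrow> nat \<Rightarrow> 'k::comm_ring_1 mat \<Rightarrow> 'k mat" where
  "contract d e M = mat d d (\<lambda>(a, b). \<Sum>c<e. M $$ (a * e + c, c * d + b))"

definition contract_rev :: "nat \<Rightarrow> nat \<Rightarrow> 'k::comm_ring_1 mat \<Rightarrow> 'k mat" where
  "contract_rev d e M = mat d d (\<lambda>(a, b). \<Sum>c<e. M $$ (c * d + a, b * e + c))"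

lemma contract_carrier [simp]: "contract d e M \<in> carrier_mat d d" "contract_rev d e M \<in> carrier_mat d d"
  by (auto simp: contract_def contract_rev_def)

text \<open>Splitting off the first tensor leg: it becomes the left factor of the product. This
  drives the induction over tensor powers.\<close>

lemma contract_kronecker:
  assumes X: "X \<in> carrier_mat d d" and M: "M \<in> carrier_mat (d * e) (d * e)"
  shows "contract d (d * e) (kronecker X M) = X * contract d e M"
proof (rule eq_matI)
  fix a b assume "a < dim_row (X * contract d e M)" "b < dim_col (X * contract d e M)"
  then have ab: "a < d" "b < d" using X by (auto simp: contract_def)
  have 1: "c1 * e + c < d * e" "(c1 * e + c) * d + b < d * (d * e)"
    "a * (d * e) + (c1 * e + c) < d * (d * e)"
    "((c1 * e + c) * d + b) div (d * e) = c1" "((c1 * e + c) * d + b) mod (d * e) = c * d + b"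
    if "c1 < d" "c < e" for c1 c
  proof -
    show *: "c1 * e + c < d * e" using that by (rule mult_add_less)
    then show "a * (d * e) + (c1 * e + c) < d * (d * e)" using ab by (auto simp: mult_add_less)
    have l: "c * d + b < d * e" using mult_add_less[OF that(2) ab(2)] by (simp add: mult.commute)
    \<comment> \<open>The same column index read with its last digit split off and with its first
      digit split off; this is the shift of legs built into \<open>contract\<close>.\<close>
    have eq: "(c1 * e + c) * d + b = c1 * (d * e) + (c * d + b)" by (simp add: algebra_simps)
    show "(c1 * e + c) * d + b < d * (d * e)" unfolding eq using that l by (intro mult_add_less) auto
    show "((c1 * e + c) * d + b) div (d * e) = c1" "((c1 * e + c) * d + b) mod (d * e) = c * d + b"
      unfolding eq using l by (simp_all only: mult_add_div_mod)
  qed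
  have "contract d (d * e) (kronecker X M) $$ (a, b) =
    (\<Sum>c1<d. \<Sum>c<e. kronecker X M $$ (a * (d * e) + (c1 * e + c), (c1 * e + c) * d + b))"
    using ab by (simp add: contract_def sum_nat_mult)
  also have "\<dots> = (\<Sum>c1<d. \<Sum>c<e. X $$ (a, c1) * M $$ (c1 * e + c, c * d + b))"
    using ab by (intro sum.cong refl) (auto simp: kronecker_index[OF X M] 1)
  also have "\<dots> = (X * contract d e M) $$ (a, b)"
    using ab by (subst index_mat_mult[OF X contract_carrier(1)]) (simp_all add: contract_def sum_distrib_left)
  finally show "contract d (d * e) (kronecker X M) $$ (a, b) = (X * contract d e M) $$ (a, b)" .
qed (use X in \<open>auto simp: contract_def\<close>)

text \<open>Here the shift sits in the row index instead of the column index, which puts the first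
  leg on the right of the product.\<close>

lemma contract_rev_kronecker:
  assumes X: "X \<in> carrier_mat d d" and M: "M \<in> carrier_mat (d * e) (d * e)"
  shows "contract_rev d (d * e) (kronecker X M) = contract_rev d e M * X"
proof (rule eq_matI)
  fix a b assume "a < dim_row (contract_rev d e M * X)" "b < dim_col (contract_rev d e M * X)"
  then have ab: "a < d" "b < d" using X by (auto simp: contract_rev_def)
  have 1: "c1 * e + c < d * e" "(c1 * e + c) * d + a < d * (d * e)"
    "b * (d * e) + (c1 * e + c) < d * (d * e)"
    "((c1 * e + c) * d + a) div (d * e) = c1" "((c1 * e + c) * d + a) mod (d * e) = c * d + a"
    if "c1 < d" "c < e" for c1 c
  proof -
    show *: "c1 * e + c < d * e" using that by (rule mult_add_less)
    then show "b * (d * e) + (c1 * e + c) < d * (d * e)" using ab by (auto simp: mult_add_less)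
    have l: "c * d + a < d * e" using mult_add_less[OF that(2) ab(1)] by (simp add: mult.commute)
    have eq: "(c1 * e + c) * d + a = c1 * (d * e) + (c * d + a)" by (simp add: algebra_simps)
    show "(c1 * e + c) * d + a < d * (d * e)" unfolding eq using that l by (intro mult_add_less) auto
    show "((c1 * e + c) * d + a) div (d * e) = c1" "((c1 * e + c) * d + a) mod (d * e) = c * d + a"
      unfolding eq using l by (simp_all only: mult_add_div_mod)
  qed
  have "contract_rev d (d * e) (kronecker X M) $$ (a, b) =
    (\<Sum>c1<d. \<Sum>c<e. kronecker X M $$ ((c1 * e + c) * d + a, b * (d * e) + (c1 * e + c)))"
    using ab by (simp add: contract_rev_def sum_nat_mult)
  also have "\<dots> = (\<Sum>c1<d. \<Sum>c<e. X $$ (c1, b) * M $$ (c * d + a, c1 * e + c))"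
    using ab by (intro sum.cong refl) (auto simp: kronecker_index[OF X M] 1)
  also have "\<dots> = (contract_rev d e M * X) $$ (a, b)"
    using ab by (subst index_mat_mult[OF contract_carrier(2) X])
      (simp_all add: contract_rev_def sum_distrib_left mult.commute)
  finally show "contract_rev d (d * e) (kronecker X M) $$ (a, b) = (contract_rev d e M * X) $$ (a, b)" .
qed (use X in \<open>auto simp: contract_rev_def\<close>)

text \<open>Inserting \<open>u\<close> on the left and evaluating \<open>w\<close> on the right
  feeds the output of each leg of \<open>u * w\<close> into the input of the preceding one. This
  rewrites the index formula for \<open>contract\<close> as a composite of morphisms, to which a
  functor can be applied.\<close>

lemma contract_outer_product:
  assumes u: "u \<in> carrier_mat (d * e) 1" and w: "w \<in> carrier_mat 1 (d * e)"
  shows "kronecker (1\<^sub>m d) w * kronecker u (1\<^sub>m d) = contract d e (u * w)"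
proof (rule eq_matI)
  let ?N = "d * e"
  fix a b assume "a < dim_row (contract d e (u * w))" "b < dim_col (contract d e (u * w))"
  then have ab: "a < d" "b < d" by (auto simp: contract_def)
  have K: "kronecker (1\<^sub>m d) w \<in> carrier_mat (d * 1) (d * ?N)"
    "kronecker u (1\<^sub>m d) \<in> carrier_mat (d * ?N) (1 * d)"
    using kronecker_carrier[OF one_carrier_mat w, of d] kronecker_carrier[OF u one_carrier_mat, of d]
    by (auto simp: mult.commute mult.left_commute)
  \<comment> \<open>The identity leg of the left factor forces the leading digit of the summation
    index to be \<open>a\<close>.\<close>
  have W: "kronecker (1\<^sub>m d) w $$ (a, i * ?N + r) = (if a = i then w $$ (0, r) else 0)"
    if "i < d" "r < ?N" for i r
    using that ab by (subst kronecker_index[OF one_carrier_mat w]) (auto simp: mult_add_less mult_add_div_mod)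
  have U: "kronecker u (1\<^sub>m d) $$ (a * ?N + (c * d + b'), b) = (if b = b' then u $$ (a * e + c, 0) else 0)"
    if "c < e" "b' < d" for c b'
  proof -
    have eq: "a * ?N + (c * d + b') = (a * e + c) * d + b'" by (simp add: algebra_simps)
    have "(a * e + c) * d + b' < ?N * d" using that ab by (intro mult_add_less)
    then show ?thesis unfolding eq using that ab
      by (subst kronecker_index[OF u one_carrier_mat]) auto
  qed
  have "(kronecker (1\<^sub>m d) w * kronecker u (1\<^sub>m d)) $$ (a, b) =
    (\<Sum>k<d * ?N. kronecker (1\<^sub>m d) w $$ (a, k) * kronecker u (1\<^sub>m d) $$ (k, b))"
    using index_mat_mult[OF K] ab by simp
  also have "\<dots> = (\<Sum>i<d. \<Sum>r<?N. kronecker (1\<^sub>m d) w $$ (a, i * ?N + r) * kronecker u (1\<^sub>m d) $$ (i * ?N + r, b))"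
    by (rule sum_nat_mult)
  also have "\<dots> = (\<Sum>i<d. if a = i then \<Sum>r<?N. w $$ (0, r) * kronecker u (1\<^sub>m d) $$ (a * ?N + r, b) else 0)"
    by (rule sum.cong[OF refl]) (auto simp: W)
  \<comment> \<open>The bound is commuted so that \<open>r\<close> can next be split as
    \<open>c * d + b'\<close>; the identity leg of the right factor then forces
    \<open>b' = b\<close>.\<close>
  also have "\<dots> = (\<Sum>r<e * d. w $$ (0, r) * kronecker u (1\<^sub>m d) $$ (a * ?N + r, b))"
    using ab by (simp add: mult.commute)
  also have "\<dots> = (\<Sum>c<e. \<Sum>b'<d. if b = b' then w $$ (0, c * d + b') * u $$ (a * e + c, 0) else 0)"
    unfolding sum_nat_mult by (intro sum.cong refl) (auto simp: U)
  also have "\<dots> = (\<Sum>c<e. w $$ (0, c * d + b) * u $$ (a * e + c, 0))"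
    using ab by simp
  also have "\<dots> = contract d e (u * w) $$ (a, b)"
  proof -
    have "a * e + c < ?N" "c * d + b < ?N" if "c < e" for c
      using that ab mult_add_less[of a d c e] mult_add_less[of c e b d] by (auto simp: mult.commute)
    then show ?thesis
      using ab by (auto simp: contract_def index_mat_mult[OF u w] mult.commute intro!: sum.cong)
  qed
  finally show "(kronecker (1\<^sub>m d) w * kronecker u (1\<^sub>m d)) $$ (a, b) = contract d e (u * w) $$ (a, b)" .
qed (use u w in \<open>auto simp: contract_def kronecker_def\<close>)

text \<open>The mirror image: \<open>u\<close> is inserted on the right and \<open>w\<close>
  evaluated on the left, which reverses the order of the factors.\<close>

lemma contract_rev_outer_product:
  assumes u: "u \<in> carrier_mat (d * e) 1" and w: "w \<in> carrier_mat 1 (d * e)"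
  shows "kronecker w (1\<^sub>m d) * kronecker (1\<^sub>m d) u = contract_rev d e (u * w)"
proof (rule eq_matI)
  let ?N = "d * e"
  fix a b assume "a < dim_row (contract_rev d e (u * w))" "b < dim_col (contract_rev d e (u * w))"
  then have ab: "a < d" "b < d" by (auto simp: contract_rev_def)
  have K: "kronecker w (1\<^sub>m d) \<in> carrier_mat (1 * d) (d * ?N)"
    "kronecker (1\<^sub>m d) u \<in> carrier_mat (d * ?N) (d * 1)"
    using kronecker_carrier[OF one_carrier_mat u, of d] kronecker_carrier[OF w one_carrier_mat, of d]
    by (auto simp: mult.commute mult.left_commute)
  have U: "kronecker (1\<^sub>m d) u $$ (i * ?N + r, b) = (if b = i then u $$ (r, 0) else 0)"
    if "i < d" "r < ?N" for i r
    using that ab by (subst kronecker_index[OF one_carrier_mat u]) (auto simp: mult_add_less mult_add_div_mod)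
  have W: "kronecker w (1\<^sub>m d) $$ (a, b * ?N + (c * d + a')) = (if a = a' then w $$ (0, b * e + c) else 0)"
    if "c < e" "a' < d" for c a'
  proof -
    have eq: "b * ?N + (c * d + a') = (b * e + c) * d + a'" by (simp add: algebra_simps)
    have "(b * e + c) * d + a' < ?N * d" using that ab by (intro mult_add_less)
    then show ?thesis unfolding eq using that ab
      by (subst kronecker_index[OF w one_carrier_mat]) auto
  qed
  have "(kronecker w (1\<^sub>m d) * kronecker (1\<^sub>m d) u) $$ (a, b) =
    (\<Sum>k<d * ?N. kronecker w (1\<^sub>m d) $$ (a, k) * kronecker (1\<^sub>m d) u $$ (k, b))"
    using index_mat_mult[OF K] ab by simp
  also have "\<dots> = (\<Sum>i<d. \<Sum>r<?N. kronecker w (1\<^sub>m d) $$ (a, i * ?N + r) * kronecker (1\<^sub>m d) u $$ (i * ?N + r, b))"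
    by (rule sum_nat_mult)
  also have "\<dots> = (\<Sum>i<d. if b = i then \<Sum>r<?N. kronecker w (1\<^sub>m d) $$ (a, b * ?N + r) * u $$ (r, 0) else 0)"
    by (rule sum.cong[OF refl]) (auto simp: U)
  also have "\<dots> = (\<Sum>r<e * d. kronecker w (1\<^sub>m d) $$ (a, b * ?N + r) * u $$ (r, 0))"
    using ab by (simp add: mult.commute)
  also have "\<dots> = (\<Sum>c<e. \<Sum>a'<d. if a = a' then w $$ (0, b * e + c) * u $$ (c * d + a', 0) else 0)"
    unfolding sum_nat_mult by (intro sum.cong refl) (auto simp: W)
  also have "\<dots> = (\<Sum>c<e. w $$ (0, b * e + c) * u $$ (c * d + a, 0))"
    using ab by simp
  also have "\<dots> = contract_rev d e (u * w) $$ (a, b)"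
  proof -
    have "b * e + c < ?N" "c * d + a < ?N" if "c < e" for c
      using that ab mult_add_less[of b d c e] mult_add_less[of c e a d] by (auto simp: mult.commute)
    then show ?thesis
      using ab by (auto simp: contract_rev_def index_mat_mult[OF u w] mult.commute intro!: sum.cong)
  qed
  finally show "(kronecker w (1\<^sub>m d) * kronecker (1\<^sub>m d) u) $$ (a, b) = contract_rev d e (u * w) $$ (a, b)" .
qed (use u w in \<open>auto simp: contract_rev_def kronecker_def\<close>)

section \<open>Finite sums of matrices and rank-one expansions\<close>

definition mat_sum :: "nat \<Rightarrow> nat \<Rightarrow> (nat \<Rightarrow> 'k::comm_ring_1 mat) \<Rightarrow> nat \<Rightarrow> 'k mat" where
  "mat_sum r c f n = mat r c (\<lambda>ij. \<Sum>k<n. f k $$ ij)"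

lemma mat_sum_carrier [simp]: "mat_sum r c f n \<in> carrier_mat r c"
  by (simp add: mat_sum_def)

lemma mat_sum_cong: "(\<And>k. k < n \<Longrightarrow> f k = g k) \<Longrightarrow> mat_sum r c f n = mat_sum r c g n"
  by (simp add: mat_sum_def)

text \<open>The dimensions are arguments of \<open>mat_sum\<close> so that the empty sum is a matrix
  of definite size.\<close>

lemma mat_sum_0: "mat_sum r c f 0 = 0\<^sub>m r c"
  by (rule eq_matI) (auto simp: mat_sum_def)

lemma mat_sum_Suc: "f n \<in> carrier_mat r c \<Longrightarrow> mat_sum r c f (Suc n) = mat_sum r c f n + f n"
  by (rule eq_matI) (auto simp: mat_sum_def)

lemma mult_mat_sum:
  assumes A: "A \<in> carrier_mat r n" and f: "\<And>k. k < N \<Longrightarrow> f k \<in> carrier_mat n m" and B: "B \<in> carrier_mat m c"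
  shows "A * mat_sum n m f N * B = mat_sum r c (\<lambda>k. A * f k * B) N"
  using f
proof (induction N)
  case 0
  then show ?case using A B by (simp add: mat_sum_0)
next
  case (Suc N)
  have f: "f N \<in> carrier_mat n m" using Suc.prems by simp
  have AfB: "A * f N * B \<in> carrier_mat r c" using A B f by simp
  have "A * mat_sum n m f (Suc N) * B = A * mat_sum n m f N * B + A * f N * B"
    using A B f by (simp add: mat_sum_Suc mult_add_distrib_mat[OF A mat_sum_carrier f]
      add_mult_distrib_mat[of _ r m])
  then show ?case using Suc.IH Suc.prems by (simp add: mat_sum_Suc[where f = "\<lambda>k. A * f k * B", OF AfB])
qed

lemma contract_mat_sum:
  assumes "\<And>k. k < N \<Longrightarrow> f k \<in> carrier_mat (d * e) (d * e)"
  shows "contract d e (mat_sum (d * e) (d * e) f N) = mat_sum d d (\<lambda>k. contract d e (f k)) N"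
    and "contract_rev d e (mat_sum (d * e) (d * e) f N) = mat_sum d d (\<lambda>k. contract_rev d e (f k)) N"
proof -
  have *: "a * e + c < d * e" "c * d + a < d * e" if "c < e" "a < d" for a c
    using that mult_add_less[of a d c e] mult_add_less[of c e a d] by (auto simp: mult.commute)
  show "contract d e (mat_sum (d * e) (d * e) f N) = mat_sum d d (\<lambda>k. contract d e (f k)) N"
    by (rule eq_matI) (auto simp: contract_def mat_sum_def * sum.swap[of _ "{..<N}"])
  show "contract_rev d e (mat_sum (d * e) (d * e) f N) = mat_sum d d (\<lambda>k. contract_rev d e (f k)) N"
    by (rule eq_matI) (auto simp: contract_rev_def mat_sum_def * sum.swap[of _ "{..<N}"])
qed

definition col_mat :: "'k::comm_ring_1 mat \<Rightarrow> nat \<Rightarrow> 'k mat" where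
  "col_mat M i = mat (dim_row M) 1 (\<lambda>(k, _). M $$ (k, i))"

definition row_mat :: "'k::comm_ring_1 mat \<Rightarrow> nat \<Rightarrow> 'k mat" where
  "row_mat M i = mat 1 (dim_col M) (\<lambda>(_, k). M $$ (i, k))"

lemma col_row_mat_carrier:
  "M \<in> carrier_mat r c \<Longrightarrow> col_mat M i \<in> carrier_mat r 1"
  "M \<in> carrier_mat r c \<Longrightarrow> row_mat M i \<in> carrier_mat 1 c"
  by (auto simp: col_mat_def row_mat_def)

text \<open>Columns times rows. For \<open>A = B\<close> the idempotent action of an integral, this
  gives its factorization through the trivial module.\<close>

lemma mult_eq_mat_sum:
  assumes "A \<in> carrier_mat r n" "B \<in> carrier_mat n c"
  shows "A * B = mat_sum r c (\<lambda>i. col_mat A i * row_mat B i) n"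
  using assms by (intro eq_matI) (auto simp: mat_sum_def index_mat_mult col_mat_def row_mat_def scalar_prod_def
    atLeast0LessThan)

lemma mult_col_mat:
  assumes "A \<in> carrier_mat r n" "B \<in> carrier_mat n c" "i < c"
  shows "A * col_mat B i = col_mat (A * B) i"
  using assms by (intro eq_matI) (auto simp: col_mat_def scalar_prod_def)

lemma row_mat_mult:
  assumes "A \<in> carrier_mat r n" "B \<in> carrier_mat n c" "i < r"
  shows "row_mat A i * B = row_mat (A * B) i"
  using assms by (intro eq_matI) (auto simp: row_mat_def scalar_prod_def)

section \<open>Tensor powers of modules\<close>

lemma fd_modulesD:
  assumes "V \<in> fd_modules scale"
  shows "snd V a \<in> carrier_mat (fst V) (fst V)" "snd V 1 = 1\<^sub>m (fst V)"
    "snd V (a * b) = snd V a * snd V b" "snd V (a + b) = snd V a + snd V b"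
    "snd V (scale c a) = c \<cdot>\<^sub>m snd V a"
  using assms by (auto simp: fd_modules_def)

lemma fd_modules_index:
  assumes "V \<in> fd_modules scale" "i < fst V" "j < fst V"
  shows "snd V (a + b) $$ (i, j) = snd V a $$ (i, j) + snd V b $$ (i, j)"
    "snd V (scale c a) $$ (i, j) = c * snd V a $$ (i, j)"
  using assms(2,3) fd_modulesD(1,4,5)[OF assms(1)] by (auto simp: carrier_matD[OF fd_modulesD(1)[OF assms(1)]])

lemma fd_modules_zero:
  assumes "V \<in> fd_modules s"
  shows "snd V 0 = 0\<^sub>m (fst V) (fst V)"
proof (rule eq_matI)
  fix i j assume "i < dim_row (0\<^sub>m (fst V) (fst V))" "j < dim_col (0\<^sub>m (fst V) (fst V))"
  then have ij: "i < fst V" "j < fst V" by simp_all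
  have "snd V 0 $$ (i, j) + 0 = snd V 0 $$ (i, j) + snd V 0 $$ (i, j)"
    using fd_modules_index(1)[OF assms ij, of 0 0] by (simp only: add_0_left add_0_right)
  then show "snd V 0 $$ (i, j) = 0\<^sub>m (fst V) (fst V) $$ (i, j)"
    unfolding add_left_cancel using ij by simp
qed (use fd_modulesD(1)[OF assms] in auto)

lemma fst_module_tensor [simp]: "fst (module_tensor \<Delta> V W) = fst V * fst W"
  by (simp add: module_tensor_def)

lemma module_homsD:
  assumes "f \<in> module_homs V W"
  shows "f \<in> carrier_mat (fst W) (fst V)" "f * snd V a = snd W a * f"
  using assms by (auto simp: module_homs_def)

context hopf_algebra
begin

abbreviation "Mods \<equiv> fd_modules scale"
abbreviation "mtensor \<equiv> module_tensor \<Delta>"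

definition munit :: "nat \<times> ('a \<Rightarrow> 'k mat)" where
  "munit = (1, \<lambda>a. \<epsilon> a \<cdot>\<^sub>m 1\<^sub>m 1)"

lemma fst_munit [simp]: "fst munit = 1"
  by (simp add: munit_def)

lemma fd_modules_dim [simp]:
  assumes "V \<in> Mods"
  shows "dim_row (snd V a) = fst V" "dim_col (snd V a) = fst V"
  using fd_modulesD(1)[OF assms, of a] by auto

lemma sw_zero [simp]: "sw a (\<lambda>x y. 0) = 0"
  by (simp add: sw_def case_prod_unfold)

lemma sw_sum: "sw a (\<lambda>x y. \<Sum>k\<in>K. f k x y) = (\<Sum>k\<in>K. sw a (f k))"
  by (induction K rule: infinite_finite_induct) (simp_all add: sw_add)

section \<open>Tensor products of modules\<close>

lemma snd_module_tensor_carrier [simp]: "snd (mtensor V W) a \<in> carrier_mat (fst V * fst W) (fst V * fst W)"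
  by (simp add: module_tensor_def)

lemma module_tensor_index:
  "i < fst V * fst W \<Longrightarrow> j < fst V * fst W \<Longrightarrow>
    snd (mtensor V W) a $$ (i, j) = sw a (\<lambda>x y. kronecker (snd V x) (snd W y) $$ (i, j))"
  by (simp add: module_tensor_def sw_def)

lemma kronecker_module_carrier:
  "V \<in> Mods \<Longrightarrow> W \<in> Mods \<Longrightarrow>
    kronecker (snd V x) (snd W y) \<in> carrier_mat (fst V * fst W) (fst V * fst W)"
  by (intro kronecker_carrier fd_modulesD(1))

lemma kronecker_module_index:
  "V \<in> Mods \<Longrightarrow> W \<in> Mods \<Longrightarrow> i < fst V * fst W \<Longrightarrow> j < fst V * fst W \<Longrightarrow>
    kronecker (snd V x) (snd W y) $$ (i, j) =
    snd V x $$ (i div fst W, j div fst W) * snd W y $$ (i mod fst W, j mod fst W)"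
  by (rule kronecker_index[OF fd_modulesD(1) fd_modulesD(1)])

text \<open>Each entry is a product of one entry for \<open>x\<close> and one for \<open>y\<close>.
  Hence the comultiplication axioms can be applied to the tensor product action entry by
  entry.\<close>

lemma bilin_kronecker:
  assumes "V \<in> Mods" "W \<in> Mods" "i < fst V * fst W" "j < fst V * fst W"
  shows "bilin (\<lambda>x y. kronecker (snd V x) (snd W y) $$ (i, j))"
  using assms by (simp add: bilin_def kronecker_module_index fd_modules_index[OF assms(1)]
      fd_modules_index[OF assms(2)] div_less_factor mod_less_factor algebra_simps)

lemma mult_module_tensor:
  assumes "V \<in> Mods" "W \<in> Mods" "i < r" "j < fst V * fst W" and A: "A \<in> carrier_mat r (fst V * fst W)"
  shows "(A * snd (mtensor V W) a) $$ (i, j) = sw a (\<lambda>x y. (A * kronecker (snd V x) (snd W y)) $$ (i, j))"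
  using assms(3,4)
  by (simp add: index_mat_mult[OF A snd_module_tensor_carrier] module_tensor_index sw_sum sw_mult_left
      index_mat_mult[OF A kronecker_module_carrier[OF assms(1,2)]])

lemma module_tensor_mult:
  assumes "V \<in> Mods" "W \<in> Mods" "i < fst V * fst W" "j < c" and A: "A \<in> carrier_mat (fst V * fst W) c"
  shows "(snd (mtensor V W) a * A) $$ (i, j) = sw a (\<lambda>x y. (kronecker (snd V x) (snd W y) * A) $$ (i, j))"
  using assms(3,4)
  by (simp add: index_mat_mult[OF snd_module_tensor_carrier A] module_tensor_index sw_sum sw_mult_right
      index_mat_mult[OF kronecker_module_carrier[OF assms(1,2)] A])

text \<open>Each module axiom is the matching axiom of \<Delta> evaluated on the bilinear entries;
  for products, the mixed product rule of Kronecker products is used as well.\<close>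

lemma module_tensor_closed:
  assumes V: "V \<in> Mods" and W: "W \<in> Mods"
  shows "mtensor V W \<in> Mods"
proof -
  note b = bilin_kronecker[OF V W]
  let ?n = "fst V * fst W"
  note dims = carrier_matD[OF snd_module_tensor_carrier]
  have 1: "snd (mtensor V W) 1 = 1\<^sub>m ?n"
    by (rule eq_matI) (simp_all add: dims module_tensor_index sw_comult_one[OF b] fd_modulesD(2)[OF V]
        fd_modulesD(2)[OF W] kronecker_one)
  have 2: "snd (mtensor V W) (a * b) = snd (mtensor V W) a * snd (mtensor V W) b" for a b
  proof (rule eq_matI)
    fix i j assume "i < dim_row (snd (mtensor V W) a * snd (mtensor V W) b)"
      "j < dim_col (snd (mtensor V W) a * snd (mtensor V W) b)"
    then have ij: "i < ?n" "j < ?n" by (auto simp: dims)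
    have "kronecker (snd V (x * x')) (snd W (y * y')) = kronecker (snd V x) (snd W y) * kronecker (snd V x') (snd W y')"
      for x x' y y'
      by (simp only: fd_modulesD(3)[OF V] fd_modulesD(3)[OF W]
          kronecker_mult[OF fd_modulesD(1)[OF V] fd_modulesD(1)[OF V] fd_modulesD(1)[OF W] fd_modulesD(1)[OF W]])
    then have "snd (mtensor V W) (a * b) $$ (i, j) = sw a (\<lambda>x y. sw b (\<lambda>x' y'.
      (kronecker (snd V x) (snd W y) * kronecker (snd V x') (snd W y')) $$ (i, j)))"
      using ij by (simp add: module_tensor_index sw_comult_mult[OF b])
    also have "\<dots> = sw a (\<lambda>x y. (kronecker (snd V x) (snd W y) * snd (mtensor V W) b) $$ (i, j))"
      by (simp add: mult_module_tensor[OF V W ij kronecker_module_carrier[OF V W]])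
    also have "\<dots> = (snd (mtensor V W) a * snd (mtensor V W) b) $$ (i, j)"
      by (simp add: module_tensor_mult[OF V W ij snd_module_tensor_carrier])
    finally show "snd (mtensor V W) (a * b) $$ (i, j) = (snd (mtensor V W) a * snd (mtensor V W) b) $$ (i, j)" .
  qed (simp_all add: dims)
  have 3: "snd (mtensor V W) (a + b) = snd (mtensor V W) a + snd (mtensor V W) b" for a b
    by (rule eq_matI) (simp_all add: dims module_tensor_index sw_comult_add[OF b])
  have 4: "snd (mtensor V W) (scale c a) = c \<cdot>\<^sub>m snd (mtensor V W) a" for c a
  proof (rule eq_matI)
    fix i j assume "i < dim_row (c \<cdot>\<^sub>m snd (mtensor V W) a)" "j < dim_col (c \<cdot>\<^sub>m snd (mtensor V W) a)"
    then have ij: "i < ?n" "j < ?n" by (auto simp: dims)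
    have "snd (mtensor V W) (scale c a) $$ (i, j) =
      sw a (\<lambda>x y. kronecker (snd V (scale c x)) (snd W y) $$ (i, j))"
      using ij by (simp add: module_tensor_index sw_comult_scale[OF b])
    also have "\<dots> = sw a (\<lambda>x y. c * kronecker (snd V x) (snd W y) $$ (i, j))"
      using ij by (simp add: kronecker_module_index[OF V W] fd_modules_index[OF V] div_less_factor mult.assoc)
    finally have "snd (mtensor V W) (scale c a) $$ (i, j) =
      sw a (\<lambda>x y. c * kronecker (snd V x) (snd W y) $$ (i, j))" .
    then show "snd (mtensor V W) (scale c a) $$ (i, j) = (c \<cdot>\<^sub>m snd (mtensor V W) a) $$ (i, j)"
      using ij by (simp add: module_tensor_index sw_mult_left dims)
  qed (simp_all add: dims)
  show ?thesis
    using 1 2 3 4 snd_module_tensor_carrier[of V W]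
    by (cases "mtensor V W") (auto simp: fd_modules_def simp flip: fst_module_tensor[of \<Delta> V W])
qed

text \<open>The objects are equal, not merely isomorphic: Kronecker products are strictly
  associative and each entry obeys coassociativity.\<close>

lemma module_tensor_assoc:
  assumes U: "U \<in> Mods" and V: "V \<in> Mods" and W: "W \<in> Mods"
  shows "mtensor (mtensor U V) W = mtensor U (mtensor V W)"
proof (rule prod_eqI)
  show "snd (mtensor (mtensor U V) W) = snd (mtensor U (mtensor V W))"
  proof (rule ext, rule eq_matI)
    fix a i j
    let ?n = "fst U * fst V * fst W"
    assume "i < dim_row (snd (mtensor U (mtensor V W)) a)" "j < dim_col (snd (mtensor U (mtensor V W)) a)"
    then have ij: "i < ?n" "j < ?n" by (auto simp: carrier_matD[OF snd_module_tensor_carrier] mult.assoc)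
    then have ij': "i < fst U * (fst V * fst W)" "j < fst U * (fst V * fst W)" by (auto simp: mult.assoc)
    define K where "K x y z = kronecker (snd U x) (kronecker (snd V y) (snd W z)) $$ (i, j)" for x y z
    note UV = module_tensor_closed[OF U V] note VW = module_tensor_closed[OF V W]
    \<comment> \<open>The two factorizations of the entry, \<open>K1\<close> and \<open>K2\<close>,
      exhibit bilinearity in the first two and in the last two slots; together they give
      trilinearity.\<close>
    have K1: "K x y z = kronecker (snd U x) (snd V y) $$ (i div fst W, j div fst W) *
        snd W z $$ (i mod fst W, j mod fst W)" for x y z
      unfolding K_def kronecker_assoc[symmetric]
      by (rule kronecker_index[OF kronecker_module_carrier[OF U V] fd_modulesD(1)[OF W] ij])
    have K2: "K x y z = snd U x $$ (i div (fst V * fst W), j div (fst V * fst W)) *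
        kronecker (snd V y) (snd W z) $$ (i mod (fst V * fst W), j mod (fst V * fst W))" for x y z
      unfolding K_def
      by (rule kronecker_index[OF fd_modulesD(1)[OF U] kronecker_module_carrier[OF V W] ij'])
    have "trilin K"
    proof -
      have "bilin (\<lambda>x y. K x y z)" for z
        unfolding K1 using bilin_kronecker[OF U V, of "i div fst W" "j div fst W"] ij
        by (simp add: bilin_def div_less_factor algebra_simps)
      moreover have "bilin (K x)" for x
        unfolding K2 using bilin_kronecker[OF V W, of "i mod (fst V * fst W)" "j mod (fst V * fst W)"] ij'
        by (simp add: bilin_def mod_less_factor algebra_simps)
      ultimately show ?thesis by (simp add: trilin_def bilin_def)
    qed
    have "snd (mtensor (mtensor U V) W) a $$ (i, j) = sw a (\<lambda>u z. sw u (\<lambda>x y. K x y z))"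
      using ij by (simp add: module_tensor_index kronecker_module_index[OF UV W] div_less_factor
        sw_mult_right K1)
    also have "\<dots> = sw a (\<lambda>x u. sw u (\<lambda>y z. K x y z))"
      by (rule sw_coassoc) fact
    also have "\<dots> = snd (mtensor U (mtensor V W)) a $$ (i, j)"
      using ij' by (simp add: module_tensor_index kronecker_module_index[OF U VW] mod_less_factor
        sw_mult_left K2)
    finally show "snd (mtensor (mtensor U V) W) a $$ (i, j) = snd (mtensor U (mtensor V W)) a $$ (i, j)" .
  qed (simp_all add: module_tensor_def mult.assoc)
qed (simp add: mult.assoc)

lemma munit_closed: "munit \<in> Mods"
  by (auto simp: munit_def fd_modules_def counit_add counit_scale counit_mult counit_one intro!: eq_matI
      simp: scalar_prod_def algebra_simps)

lemma module_hom_sw: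
  assumes V: "V \<in> Mods" and "i < fst V" "j < fst V"
  shows "sw a (\<lambda>x y. snd V (f x y) $$ (i, j)) = snd V (sw a f) $$ (i, j)"
  by (rule sw_hom) (rule fd_modules_index[OF assms])

lemma module_tensor_unit:
  assumes V: "V \<in> Mods"
  shows "mtensor V munit = V" "mtensor munit V = V"
proof -
  have "snd (mtensor V munit) a $$ (i, j) = snd V a $$ (i, j)" if "i < fst V" "j < fst V" for a i j
  proof -
    have "snd (mtensor V munit) a $$ (i, j) = sw a (\<lambda>x y. snd V (scale (\<epsilon> y) x) $$ (i, j))"
      using that kronecker_module_index[OF V munit_closed, of i j]
      by (simp add: munit_def module_tensor_index fd_modules_index[OF V] mult.commute)
    also have "\<dots> = snd V a $$ (i, j)"
      by (simp add: module_hom_sw[OF V that] sw_counit_right[of "\<lambda>x. x"] lin_def)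
    finally show ?thesis .
  qed
  then have "snd (mtensor V munit) a = snd V a" for a
    by (intro eq_matI) (simp_all add: V module_tensor_def)
  then show "mtensor V munit = V" by (intro prod_eqI) auto
  have "snd (mtensor munit V) a $$ (i, j) = snd V a $$ (i, j)" if "i < fst V" "j < fst V" for a i j
  proof -
    have "snd (mtensor munit V) a $$ (i, j) = sw a (\<lambda>x y. snd V (scale (\<epsilon> x) y) $$ (i, j))"
      using that kronecker_module_index[OF munit_closed V, of i j]
      by (simp add: munit_def module_tensor_index fd_modules_index[OF V])
    also have "\<dots> = snd V a $$ (i, j)"
      by (simp add: module_hom_sw[OF V that] sw_counit_left[of "\<lambda>x. x"] lin_def)
    finally show ?thesis .
  qed
  then have "snd (mtensor munit V) a = snd V a" for a
    by (intro eq_matI) (simp_all add: V module_tensor_def)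
  then show "mtensor munit V = V" by (intro prod_eqI) auto
qed

lemma kronecker_module_homs:
  assumes V: "V \<in> Mods" and V': "V' \<in> Mods" and W: "W \<in> Mods" and W': "W' \<in> Mods"
    and f: "f \<in> module_homs V V'" and g: "g \<in> module_homs W W'"
  shows "kronecker f g \<in> module_homs (mtensor V W) (mtensor V' W')"
proof -
  note fc = module_homsD(1)[OF f] note gc = module_homsD(1)[OF g]
  have K: "kronecker f g \<in> carrier_mat (fst V' * fst W') (fst V * fst W)"
    using fc gc by simp
  have "kronecker f g * snd (mtensor V W) a = snd (mtensor V' W') a * kronecker f g" for a
  proof (rule eq_matI)
    fix i j assume "i < dim_row (snd (mtensor V' W') a * kronecker f g)" "j < dim_col (snd (mtensor V' W') a * kronecker f g)"
    then have ij: "i < fst V' * fst W'" "j < fst V * fst W"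
      using K by (auto simp: module_tensor_def)
    have "kronecker f g * kronecker (snd V x) (snd W y) = kronecker (snd V' x) (snd W' y) * kronecker f g" for x y
      by (simp add: kronecker_mult[OF fc fd_modulesD(1)[OF V] gc fd_modulesD(1)[OF W]]
        kronecker_mult[OF fd_modulesD(1)[OF V'] fc fd_modulesD(1)[OF W'] gc] module_homsD(2)[OF f] module_homsD(2)[OF g])
    then show "(kronecker f g * snd (mtensor V W) a) $$ (i, j) = (snd (mtensor V' W') a * kronecker f g) $$ (i, j)"
      by (simp add: mult_module_tensor[OF V W ij K] module_tensor_mult[OF V' W' ij K])
  qed (use K in \<open>auto simp: module_tensor_def\<close>)
  then show ?thesis using K by (simp add: module_homs_def)
qed

section \<open>Tensor powers and the action of an integral on them\<close>

primrec tensor_pow :: "nat \<times> ('a \<Rightarrow> 'k mat) \<Rightarrow> nat \<Rightarrow> nat \<times> ('a \<Rightarrow> 'k mat)" where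
  "tensor_pow V 0 = V"
| "tensor_pow V (Suc m) = mtensor V (tensor_pow V m)"

text \<open>\<open>tensor_pow V m\<close> has \<open>m + 1\<close> factors, like
  \<open>power_sum m\<close>; its dimension is kept in the form \<open>d * e\<close> expected by
  \<open>contract\<close>.\<close>

lemma fst_tensor_pow: "fst (tensor_pow V m) = fst V * fst V ^ m"
  by (induction m) auto

lemma tensor_pow_closed: "V \<in> Mods \<Longrightarrow> tensor_pow V m \<in> Mods"
  by (induction m) (auto intro: module_tensor_closed)

text \<open>Strict associativity lets the new factor join at either end. This is what makes (id
  \<otimes> w) and (u \<otimes> id) composable.\<close>

lemma tensor_pow_Suc_right: "V \<in> Mods \<Longrightarrow> mtensor (tensor_pow V m) V = tensor_pow V (Suc m)"
  by (induction m) (simp_all add: module_tensor_assoc tensor_pow_closed)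

text \<open>An entry of a contraction is a sum of entries, so contraction commutes with the Sweedler
  sum defining the action, and \<open>contract_kronecker\<close> follows the recursion of
  \<open>power_sum\<close>.\<close>

lemma contract_tensor_pow:
  assumes V: "V \<in> Mods"
  shows "contract (fst V) (fst V ^ m) (snd (tensor_pow V m) a) = snd V (power_sum m a)"
proof (induction m arbitrary: a)
  case 0
  show ?case by (rule eq_matI) (simp_all add: V contract_def)
next
  case (Suc m)
  let ?d = "fst V" let ?e = "fst V ^ m"
  note W = tensor_pow_closed[OF V, of m]
  have Wc: "snd (tensor_pow V m) y \<in> carrier_mat (?d * ?e) (?d * ?e)" for y
    using fd_modulesD(1)[OF W] by (simp add: fst_tensor_pow)
  show ?case
  proof (rule eq_matI)
    fix i j assume "i < dim_row (snd V (power_sum (Suc m) a))" "j < dim_col (snd V (power_sum (Suc m) a))"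
    then have ij: "i < ?d" "j < ?d" by (simp_all add: V)
    have 1: "i * (?d * ?e) + c < ?d * (?d * ?e)" "c * ?d + j < ?d * (?d * ?e)" if "c < ?d * ?e" for c
      using mult_add_less[OF ij(1) that] mult_add_less[OF that ij(2)] by (auto simp: ac_simps)
    have "contract ?d (?d ^ Suc m) (snd (tensor_pow V (Suc m)) a) $$ (i, j) =
      sw a (\<lambda>x y. contract ?d (?d * ?e) (kronecker (snd V x) (snd (tensor_pow V m) y)) $$ (i, j))"
      using ij by (simp add: contract_def module_tensor_index fst_tensor_pow 1 sw_sum)
    also have "\<dots> = sw a (\<lambda>x y. snd V (x * power_sum m y) $$ (i, j))"
      by (simp add: contract_kronecker[OF fd_modulesD(1)[OF V] Wc] Suc.IH fd_modulesD(3)[OF V])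
    also have "\<dots> = snd V (power_sum (Suc m) a) $$ (i, j)"
      using ij by (simp add: module_hom_sw[OF V])
    finally show "contract ?d (?d ^ Suc m) (snd (tensor_pow V (Suc m)) a) $$ (i, j) =
      snd V (power_sum (Suc m) a) $$ (i, j)" .
  qed (simp_all add: V contract_def)
qed

lemma contract_rev_tensor_pow:
  assumes V: "V \<in> Mods"
  shows "contract_rev (fst V) (fst V ^ m) (snd (tensor_pow V m) a) = snd V (rev_power_sum m a)"
proof (induction m arbitrary: a)
  case 0
  show ?case by (rule eq_matI) (simp_all add: V contract_rev_def)
next
  case (Suc m)
  let ?d = "fst V" let ?e = "fst V ^ m"
  note W = tensor_pow_closed[OF V, of m]
  have Wc: "snd (tensor_pow V m) y \<in> carrier_mat (?d * ?e) (?d * ?e)" for y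
    using fd_modulesD(1)[OF W] by (simp add: fst_tensor_pow)
  show ?case
  proof (rule eq_matI)
    fix i j assume "i < dim_row (snd V (rev_power_sum (Suc m) a))" "j < dim_col (snd V (rev_power_sum (Suc m) a))"
    then have ij: "i < ?d" "j < ?d" by (simp_all add: V)
    have 1: "j * (?d * ?e) + c < ?d * (?d * ?e)" "c * ?d + i < ?d * (?d * ?e)" if "c < ?d * ?e" for c
      using mult_add_less[OF ij(2) that] mult_add_less[OF that ij(1)] by (auto simp: ac_simps)
    have "contract_rev ?d (?d ^ Suc m) (snd (tensor_pow V (Suc m)) a) $$ (i, j) =
      sw a (\<lambda>x y. contract_rev ?d (?d * ?e) (kronecker (snd V x) (snd (tensor_pow V m) y)) $$ (i, j))"
      using ij by (simp add: contract_rev_def module_tensor_index fst_tensor_pow 1 sw_sum)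
    also have "\<dots> = sw a (\<lambda>x y. snd V (rev_power_sum m y * x) $$ (i, j))"
      by (simp add: contract_rev_kronecker[OF fd_modulesD(1)[OF V] Wc] Suc.IH fd_modulesD(3)[OF V])
    also have "\<dots> = snd V (rev_power_sum (Suc m) a) $$ (i, j)"
      using ij by (simp add: module_hom_sw[OF V])
    finally show "contract_rev ?d (?d ^ Suc m) (snd (tensor_pow V (Suc m)) a) $$ (i, j) =
      snd V (rev_power_sum (Suc m) a) $$ (i, j)" .
  qed (simp_all add: V contract_rev_def)
qed

text \<open>The columns are invariant vectors because \<Lambda> is a left integral, and the rows are
  invariant functionals because it is also a right integral.\<close>

lemma integral_homs:
  assumes V: "V \<in> Mods" and \<Lambda>: "is_left_integral scale \<epsilon> \<Lambda>" "\<epsilon> \<Lambda> = 1"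
  shows "i < fst V \<Longrightarrow> col_mat (snd V \<Lambda>) i \<in> module_homs munit V"
    and "i < fst V \<Longrightarrow> row_mat (snd V \<Lambda>) i \<in> module_homs V munit"
    and "snd V \<Lambda> \<in> module_homs V V"
proof -
  note c = fd_modulesD(1)[OF V]
  have 1: "snd V a * snd V \<Lambda> = \<epsilon> a \<cdot>\<^sub>m snd V \<Lambda>" for a
    using \<Lambda>(1) by (simp flip: fd_modulesD(3)[OF V] fd_modulesD(5)[OF V] add: is_left_integral_def)
  have 2: "snd V \<Lambda> * snd V a = \<epsilon> a \<cdot>\<^sub>m snd V \<Lambda>" for a
    by (simp flip: fd_modulesD(3)[OF V] fd_modulesD(5)[OF V] add: antipode_integral(2)[OF \<Lambda>])
  show "snd V \<Lambda> \<in> module_homs V V" using 1 2 c by (simp add: module_homs_def)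
  show "col_mat (snd V \<Lambda>) i \<in> module_homs munit V" if "i < fst V"
    using that by (auto simp: munit_def module_homs_def mult_col_mat[OF c c] 1 col_row_mat_carrier[OF c] intro!: eq_matI)
      (auto simp: col_mat_def scalar_prod_def V)
  show "row_mat (snd V \<Lambda>) i \<in> module_homs V munit" if "i < fst V"
    using that by (auto simp: munit_def module_homs_def row_mat_mult[OF c c] 2 col_row_mat_carrier[OF c] intro!: eq_matI)
      (auto simp: row_mat_def scalar_prod_def V)
qed

end

section \<open>Tensor equivalences\<close>

text \<open>The left regular representation, written in a basis: an element acting as zero kills 1,
  hence is zero.\<close>

lemma (in fd_algebra) faithful_module:
  obtains V where "V \<in> fd_modules scale" "\<And>a. snd V a = 0\<^sub>m (fst V) (fst V) \<Longrightarrow> a = 0"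
proof -
  obtain B0 where "finite B0" "span B0 = UNIV" using finite_dimensional by blast
  then obtain B where B: "B \<subseteq> B0" "independent B" "B0 \<subseteq> span B"
    using maximal_independent_subset by blast
  have finB: "finite B" using B(1) \<open>finite B0\<close> finite_subset by blast
  have "span B0 \<subseteq> span B" using B(3) by (simp add: span_minimal subspace_span)
  then have sp: "v \<in> span B" for v using \<open>span B0 = UNIV\<close> by auto
  obtain bs where bs: "set bs = B" "distinct bs" using finite_distinct_list[OF finB] by blast
  let ?d = "length bs" let ?r = "representation B"
  define \<rho> where "\<rho> a = mat ?d ?d (\<lambda>(i, j). ?r (a * bs ! j) (bs ! i))" for a
  have r_add: "?r (u + v) b = ?r u b + ?r v b" for u v b
    by (simp add: representation_add[OF B(2) sp sp])
  have r_scale: "?r (scale c v) b = c * ?r v b" for c v b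
    by (simp add: representation_scale[OF B(2) sp])
  have r_sum: "?r (sum f I) b = (\<Sum>i\<in>I. ?r (f i) b)" for f :: "'z \<Rightarrow> 'a" and I b
    by (simp add: representation_sum[OF B(2) sp])
  have expand: "v = (\<Sum>k<?d. scale (?r v (bs ! k)) (bs ! k))" for v
  proof -
    have "v = (\<Sum>b\<in>B. scale (?r v b) b)"
      using sum_representation_eq[OF B(2) sp finB subset_refl] by simp
    also have "\<dots> = (\<Sum>k<?d. scale (?r v (bs ! k)) (bs ! k))"
      using sum.reindex_bij_betw[OF bij_betw_nth[OF bs(2) refl refl], of "\<lambda>b. scale (?r v b) b"] bs(1)
      by simp
    finally show ?thesis .
  qed
  have "(?d, \<rho>) \<in> fd_modules scale"
  proof -
    have "\<rho> 1 = 1\<^sub>m ?d"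
      unfolding \<rho>_def using bs B(2)
      by (intro eq_matI) (auto simp: representation_basis nth_eq_iff_index_eq)
    moreover have "\<rho> (a * b) = \<rho> a * \<rho> b" for a b
    proof (rule eq_matI)
      fix i j assume "i < dim_row (\<rho> a * \<rho> b)" "j < dim_col (\<rho> a * \<rho> b)"
      then have ij: "i < ?d" "j < ?d" by (auto simp: \<rho>_def)
      have "a * (b * bs ! j) = (\<Sum>k<?d. scale (?r (b * bs ! j) (bs ! k)) (a * bs ! k))"
        by (subst expand[of "b * bs ! j"]) (simp add: sum_distrib_left scale_mult_right)
      then have "?r (a * b * bs ! j) (bs ! i) =
        (\<Sum>k<?d. ?r (b * bs ! j) (bs ! k) * ?r (a * bs ! k) (bs ! i))"
        by (simp add: mult.assoc r_sum r_scale)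
      then show "\<rho> (a * b) $$ (i, j) = (\<rho> a * \<rho> b) $$ (i, j)"
        using ij by (simp add: \<rho>_def scalar_prod_def atLeast0LessThan mult.commute)
    qed (simp_all add: \<rho>_def)
    moreover have "\<rho> (a + b) = \<rho> a + \<rho> b" for a b
      unfolding \<rho>_def by (rule eq_matI) (auto simp: distrib_right r_add)
    moreover have "\<rho> (scale c a) = c \<cdot>\<^sub>m \<rho> a" for c a
      unfolding \<rho>_def by (rule eq_matI) (auto simp: scale_mult_left r_scale)
    ultimately show ?thesis by (auto simp: fd_modules_def \<rho>_def)
  qed
  moreover have "a = 0" if zero: "\<rho> a = 0\<^sub>m ?d ?d" for a
  proof -
    have "?r (a * bs ! j) (bs ! i) = 0" if "i < ?d" "j < ?d" for i j
      using arg_cong[OF zero, of "\<lambda>M. M $$ (i, j)"] that by (simp add: \<rho>_def)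
    then have "a * bs ! j = 0" if "j < ?d" for j
      using that by (subst expand) simp
    then have "a * 1 = 0"
      by (subst expand[of 1]) (simp add: sum_distrib_left scale_mult_right)
    then show ?thesis by simp
  qed
  ultimately show thesis using that[of "(?d, \<rho>)"] by simp
qed

section \<open>Module homomorphisms and isomorphisms as matrices\<close>

lemma mult_mat_assoc:
  "dim_col A = dim_row B \<Longrightarrow> dim_col B = dim_row C \<Longrightarrow> A * B * C = A * (B * (C :: 'k::comm_ring_1 mat))"
  using assoc_mult_mat[of A "dim_row A" "dim_col A" B "dim_col B" C "dim_col C"]
  by (metis carrier_matI)

lemma kronecker_mult_dim:
  "dim_col A = dim_row C \<Longrightarrow> dim_col B = dim_row D \<Longrightarrow>
   kronecker A B * kronecker C D = kronecker (A * C) (B * (D :: 'k::comm_ring_1 mat))"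
  by (rule kronecker_mult[of A "dim_row A" "dim_col A" C "dim_col C" B "dim_row B" "dim_col B" D "dim_col D"])
    auto

lemma kronecker_dim [simp]:
  "dim_row (kronecker A B) = dim_row A * dim_row B" "dim_col (kronecker A B) = dim_col A * dim_col B"
  by (simp_all add: kronecker_def)

lemma one_smult_mat: "(1::'k::comm_ring_1) \<cdot>\<^sub>m M = M"
  by (rule eq_matI) auto

lemma one_mult_mat_dim:
  "dim_row A = n \<Longrightarrow> 1\<^sub>m n * A = (A :: 'k::comm_ring_1 mat)"
  "dim_col A = n \<Longrightarrow> A * 1\<^sub>m n = (A :: 'k::comm_ring_1 mat)"
  by (auto intro: left_mult_one_mat right_mult_one_mat)

text \<open>The inverse is carried along explicitly, so that it can be composed, tensored and
  cancelled.\<close>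

definition module_iso ::
  "nat \<times> ('a \<Rightarrow> 'k::field mat) \<Rightarrow> nat \<times> ('a \<Rightarrow> 'k mat) \<Rightarrow> 'k mat \<Rightarrow> 'k mat \<Rightarrow> bool" where
  "module_iso V W f g \<longleftrightarrow> f \<in> module_homs V W \<and> g \<in> module_homs W V \<and> g * f = 1\<^sub>m (fst V) \<and> f * g = 1\<^sub>m (fst W)"

lemma is_iso_rep_category:
  "is_iso (rep_category scale \<Delta> \<epsilon>) V W f \<longleftrightarrow> (\<exists>g. module_iso V W f g)"
  by (auto simp: is_iso_def rep_category_def module_iso_def)

lemma module_isoD:
  assumes "module_iso V W f g"
  shows "f \<in> module_homs V W" "g \<in> module_homs W V" "g * f = 1\<^sub>m (fst V)" "f * g = 1\<^sub>m (fst W)"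
    "dim_row f = fst W" "dim_col f = fst V" "dim_row g = fst V" "dim_col g = fst W"
  using assms by (auto simp: module_iso_def dest: module_homsD(1))

lemma module_iso_cancel:
  assumes "module_iso V W f g"
  shows "dim_row x = fst V \<Longrightarrow> g * (f * x) = x" "dim_row y = fst W \<Longrightarrow> f * (g * y) = y"
  using module_isoD[OF assms] by (simp_all add: mult_mat_assoc[symmetric] one_mult_mat_dim)

lemma module_homs_comp:
  assumes f: "f \<in> module_homs U V" and g: "g \<in> module_homs V W"
    and "U \<in> fd_modules s" "V \<in> fd_modules s" "W \<in> fd_modules s"
  shows "g * f \<in> module_homs U W"
proof -
  note d = carrier_matD[OF module_homsD(1)[OF f]] carrier_matD[OF module_homsD(1)[OF g]]
    carrier_matD[OF fd_modulesD(1)[OF assms(3)]] carrier_matD[OF fd_modulesD(1)[OF assms(4)]]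
    carrier_matD[OF fd_modulesD(1)[OF assms(5)]]
  have "g * f * snd U a = snd W a * (g * f)" for a
  proof -
    have "g * f * snd U a = g * (f * snd U a)" by (simp add: mult_mat_assoc d)
    also have "\<dots> = g * snd V a * f" by (simp add: module_homsD(2)[OF f] mult_mat_assoc d)
    also have "\<dots> = snd W a * (g * f)" by (simp add: module_homsD(2)[OF g] mult_mat_assoc d)
    finally show ?thesis .
  qed
  then show ?thesis using d by (auto simp: module_homs_def)
qed

lemma one_module_homs:
  assumes "V \<in> fd_modules s"
  shows "1\<^sub>m (fst V) \<in> module_homs V V"
proof -
  have "1\<^sub>m (fst V) * snd V a = snd V a * 1\<^sub>m (fst V)" for a
    using fd_modulesD(1)[OF assms, of a] by simp
  then show ?thesis by (simp add: module_homs_def)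
qed

lemma module_homs_add:
  assumes "f \<in> module_homs X Y" "g \<in> module_homs X Y" "X \<in> fd_modules s" "Y \<in> fd_modules s"
  shows "f + g \<in> module_homs X Y"
proof -
  note d = module_homsD(1)[OF assms(1)] module_homsD(1)[OF assms(2)]
  have "(f + g) * snd X a = snd Y a * (f + g)" for a
    by (simp add: add_mult_distrib_mat[OF d fd_modulesD(1)[OF assms(3)]]
        mult_add_distrib_mat[OF fd_modulesD(1)[OF assms(4)] d] module_homsD(2)[OF assms(1)]
        module_homsD(2)[OF assms(2)])
  then show ?thesis using d by (simp add: module_homs_def)
qed

lemma module_iso_comp:
  assumes fi: "module_iso U V f f'" and gi: "module_iso V W g g'"
    and m: "U \<in> fd_modules s" "V \<in> fd_modules s" "W \<in> fd_modules s"
  shows "module_iso U W (g * f) (f' * g')"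
proof -
  note f = module_isoD[OF fi] note g = module_isoD[OF gi]
  show ?thesis
    using module_homs_comp[OF f(1) g(1) m] module_homs_comp[OF g(2) f(2) m(3,2,1)]
    by (simp add: module_iso_def mult_mat_assoc module_iso_cancel[OF fi] module_iso_cancel[OF gi] f g)
qed

lemma (in hopf_algebra) module_iso_kronecker:
  assumes "module_iso V V' f f'" "module_iso W W' g g'" "V \<in> Mods" "V' \<in> Mods" "W \<in> Mods" "W' \<in> Mods"
  shows "module_iso (mtensor V W) (mtensor V' W') (kronecker f g) (kronecker f' g')"
proof -
  note f = module_isoD[OF assms(1)] note g = module_isoD[OF assms(2)]
  show ?thesis
    using kronecker_module_homs[OF assms(3-6) f(1) g(1)] kronecker_module_homs[OF assms(4,3,6,5) f(2) g(2)]
    by (simp add: module_iso_def kronecker_mult_dim f g kronecker_one)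
qed

lemma module_iso_refl: "V \<in> fd_modules s \<Longrightarrow> module_iso V V (1\<^sub>m (fst V)) (1\<^sub>m (fst V))"
  by (simp add: module_iso_def one_module_homs)

section \<open>Functors between module categories\<close>

lemma linear_functor_rep:
  assumes "linear_functor (rep_category s \<Delta> \<epsilon>) (rep_category s' \<Delta>' \<epsilon>') F Fm"
  shows "X \<in> fd_modules s \<Longrightarrow> F X \<in> fd_modules s'"
    and "X \<in> fd_modules s \<Longrightarrow> Fm X X (1\<^sub>m (fst X)) = 1\<^sub>m (fst (F X))"
    and "X \<in> fd_modules s \<Longrightarrow> Y \<in> fd_modules s \<Longrightarrow> f \<in> module_homs X Y \<Longrightarrow>
      Fm X Y f \<in> module_homs (F X) (F Y)"
    and "X \<in> fd_modules s \<Longrightarrow> Y \<in> fd_modules s \<Longrightarrow> Z \<in> fd_modules s \<Longrightarrow> f \<in> module_homs X Y \<Longrightarrow>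
      g \<in> module_homs Y Z \<Longrightarrow> Fm X Z (g * f) = Fm Y Z g * Fm X Y f"
    and "X \<in> fd_modules s \<Longrightarrow> Y \<in> fd_modules s \<Longrightarrow> f \<in> module_homs X Y \<Longrightarrow> g \<in> module_homs X Y \<Longrightarrow>
      Fm X Y (f + g) = Fm X Y f + Fm X Y g"
    and "X \<in> fd_modules s \<Longrightarrow> Y \<in> fd_modules s \<Longrightarrow> f \<in> module_homs X Y \<Longrightarrow>
      Fm X Y (c \<cdot>\<^sub>m f) = c \<cdot>\<^sub>m Fm X Y f"
  using assms unfolding linear_functor_def by (simp_all add: rep_category_def)

text \<open>This fixes the witnesses of a gauge equivalence together with integrals of counit 1. The
  tensor structure is on \<open>F\<close>; the quasi-inverse \<open>G\<close> is just a linear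
  functor.\<close>

locale gauge_equivalence =
  A: hopf_algebra scale \<Delta> \<epsilon> S + B: hopf_algebra scale' \<Delta>' \<epsilon>' S'
  for scale :: "'k::field \<Rightarrow> 'a::ring_1 \<Rightarrow> 'a" and \<Delta> \<epsilon> S
    and scale' :: "'k \<Rightarrow> 'b::ring_1 \<Rightarrow> 'b" and \<Delta>' \<epsilon>' S' +
  fixes F :: "nat \<times> ('a \<Rightarrow> 'k mat) \<Rightarrow> nat \<times> ('b \<Rightarrow> 'k mat)" and Fm
    and G :: "nat \<times> ('b \<Rightarrow> 'k mat) \<Rightarrow> nat \<times> ('a \<Rightarrow> 'k mat)" and Gm
    and \<eta> \<theta> J j and \<Lambda> :: 'a and \<Lambda>' :: 'b
  assumes F: "linear_functor (rep_category scale \<Delta> \<epsilon>) (rep_category scale' \<Delta>' \<epsilon>') F Fm"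
    and G: "linear_functor (rep_category scale' \<Delta>' \<epsilon>') (rep_category scale \<Delta> \<epsilon>) G Gm"
    and \<eta>: "natural_iso (rep_category scale \<Delta> \<epsilon>) (rep_category scale \<Delta> \<epsilon>) (\<lambda>X. X) (\<lambda>X Y f. f)
      (\<lambda>X. G (F X)) (\<lambda>X Y f. Gm (F X) (F Y) (Fm X Y f)) \<eta>"
    and \<theta>: "natural_iso (rep_category scale' \<Delta>' \<epsilon>') (rep_category scale' \<Delta>' \<epsilon>')
      (\<lambda>X. F (G X)) (\<lambda>X Y f. Fm (G X) (G Y) (Gm X Y f)) (\<lambda>X. X) (\<lambda>X Y f. f) \<theta>"
    and J: "tensor_structure (rep_category scale \<Delta> \<epsilon>) (rep_category scale' \<Delta>' \<epsilon>') F Fm J j"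
    and integral: "is_left_integral scale \<epsilon> \<Lambda>" "\<epsilon> \<Lambda> = 1"
    and integral': "is_left_integral scale' \<epsilon>' \<Lambda>'" "\<epsilon>' \<Lambda>' = 1"
begin

lemmas F_obj = linear_functor_rep(1)[OF F] and F_one = linear_functor_rep(2)[OF F]
  and F_hom = linear_functor_rep(3)[OF F] and F_comp = linear_functor_rep(4)[OF F]
  and F_add = linear_functor_rep(5)[OF F] and F_smult = linear_functor_rep(6)[OF F]
  and G_obj = linear_functor_rep(1)[OF G] and G_hom = linear_functor_rep(3)[OF G]

section \<open>The functor \<open>F\<close> is fully faithful\<close>

lemma \<eta>_iso: "X \<in> A.Mods \<Longrightarrow> \<exists>g. module_iso X (G (F X)) (\<eta> X) g"
  using \<eta> by (simp add: natural_iso_def is_iso_rep_category) (simp add: rep_category_def)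

lemma \<eta>_nat: "X \<in> A.Mods \<Longrightarrow> Y \<in> A.Mods \<Longrightarrow> f \<in> module_homs X Y \<Longrightarrow>
    \<eta> Y * f = Gm (F X) (F Y) (Fm X Y f) * \<eta> X"
  using \<eta> by (simp add: natural_iso_def rep_category_def)

lemma \<theta>_iso: "X \<in> B.Mods \<Longrightarrow> \<exists>g. module_iso (F (G X)) X (\<theta> X) g"
  using \<theta> by (simp add: natural_iso_def is_iso_rep_category) (simp add: rep_category_def)

lemma \<theta>_nat: "X \<in> B.Mods \<Longrightarrow> Y \<in> B.Mods \<Longrightarrow> f \<in> module_homs X Y \<Longrightarrow>
    \<theta> Y * Fm (G X) (G Y) (Gm X Y f) = f * \<theta> X"
  using \<theta> by (simp add: natural_iso_def rep_category_def)

lemma F_faithful: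
  assumes X: "X \<in> A.Mods" and Y: "Y \<in> A.Mods"
    and f: "f \<in> module_homs X Y" and g: "g \<in> module_homs X Y" and eq: "Fm X Y f = Fm X Y g"
  shows "f = g"
proof -
  obtain h where h: "module_iso Y (G (F Y)) (\<eta> Y) h" using \<eta>_iso[OF Y] by blast
  note h = module_isoD[OF h]
  have "f = h * (\<eta> Y * f)" "g = h * (\<eta> Y * g)"
    using h f g by (auto simp: mult_mat_assoc[symmetric] one_mult_mat_dim dest!: module_homsD(1))
  moreover have "\<eta> Y * f = \<eta> Y * g" by (simp add: \<eta>_nat[OF X Y] f g eq)
  ultimately show ?thesis by simp
qed

lemma G_faithful:
  assumes X: "X \<in> B.Mods" and Y: "Y \<in> B.Mods"
    and f: "f \<in> module_homs X Y" and g: "g \<in> module_homs X Y" and eq: "Gm X Y f = Gm X Y g"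
  shows "f = g"
proof -
  obtain h where h: "module_iso (F (G X)) X (\<theta> X) h" using \<theta>_iso[OF X] by blast
  note h = module_isoD[OF h]
  have "f = (f * \<theta> X) * h" "g = (g * \<theta> X) * h"
    using h f g by (auto simp: mult_mat_assoc one_mult_mat_dim dest!: module_homsD(1))
  moreover have "f * \<theta> X = g * \<theta> X" by (simp add: \<theta>_nat[OF X Y, symmetric] f g eq)
  ultimately show ?thesis by simp
qed

text \<open>Conjugating G(g) by \<eta> gives a candidate \<open>f\<close>. By naturality of \<eta>,
  G sends F(f) and g to the same morphism, and G is faithful.\<close>

lemma F_full:
  assumes X: "X \<in> A.Mods" and Y: "Y \<in> A.Mods" and g: "g \<in> module_homs (F X) (F Y)"
  obtains f where "f \<in> module_homs X Y" "Fm X Y f = g"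
proof -
  obtain h where hi: "module_iso Y (G (F Y)) (\<eta> Y) h" using \<eta>_iso[OF Y] by blast
  obtain k where k: "module_iso X (G (F X)) (\<eta> X) k" using \<eta>_iso[OF X] by blast
  note h = module_isoD[OF hi] note k = module_isoD[OF k]
  have FX: "F X \<in> B.Mods" and FY: "F Y \<in> B.Mods" by (simp_all add: F_obj X Y)
  have GX: "G (F X) \<in> A.Mods" and GY: "G (F Y) \<in> A.Mods" by (simp_all add: G_obj FX FY)
  have Gg: "Gm (F X) (F Y) g \<in> module_homs (G (F X)) (G (F Y))" by (rule G_hom[OF FX FY g])
  define f where "f = h * (Gm (F X) (F Y) g * \<eta> X)"
  have f: "f \<in> module_homs X Y"
    unfolding f_def
    by (rule module_homs_comp[OF module_homs_comp[OF k(1) Gg X GX GY] h(2) X GY Y])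
  note Gd = carrier_matD[OF module_homsD(1)[OF Gg]]
  note Gd' = carrier_matD[OF module_homsD(1)[OF G_hom[OF FX FY F_hom[OF X Y f]]]]
  have "Gm (F X) (F Y) (Fm X Y f) * \<eta> X = \<eta> Y * f" by (rule \<eta>_nat[OF X Y f, symmetric])
  also have "\<dots> = Gm (F X) (F Y) g * \<eta> X"
    unfolding f_def by (rule module_iso_cancel[OF hi]) (simp add: Gd)
  finally have "Gm (F X) (F Y) (Fm X Y f) * \<eta> X * k = Gm (F X) (F Y) g * \<eta> X * k" by simp
  then have "Gm (F X) (F Y) (Fm X Y f) = Gm (F X) (F Y) g"
    by (simp add: mult_mat_assoc h k Gd Gd' one_mult_mat_dim)
  then have "Fm X Y f = g" by (rule G_faithful[OF FX FY F_hom[OF X Y f] g])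
  then show thesis using that f by blast
qed

section \<open>Coherence of the tensor structure\<close>

lemma munit_eq: "unit_obj (rep_category scale \<Delta> \<epsilon>) = A.munit" "unit_obj (rep_category scale' \<Delta>' \<epsilon>') = B.munit"
  by (simp_all add: rep_category_def A.munit_def B.munit_def)

lemma J_iso: "X \<in> A.Mods \<Longrightarrow> Y \<in> A.Mods \<Longrightarrow>
    \<exists>g. module_iso (B.mtensor (F X) (F Y)) (F (A.mtensor X Y)) (J X Y) g"
  using J by (simp add: tensor_structure_def is_iso_rep_category) (simp add: rep_category_def)

lemma j_iso: "\<exists>g. module_iso B.munit (F A.munit) j g"
  using J by (simp add: tensor_structure_def is_iso_rep_category munit_eq)

lemma J_dim [simp]:
  assumes "X \<in> A.Mods" "Y \<in> A.Mods"
  shows "dim_row (J X Y) = fst (F (A.mtensor X Y))" "dim_col (J X Y) = fst (F X) * fst (F Y)"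
proof -
  obtain g where "module_iso (B.mtensor (F X) (F Y)) (F (A.mtensor X Y)) (J X Y) g"
    using J_iso[OF assms] by blast
  from module_isoD(5,6)[OF this]
  show "dim_row (J X Y) = fst (F (A.mtensor X Y))" "dim_col (J X Y) = fst (F X) * fst (F Y)"
    by simp_all
qed

lemma J_nat: "X \<in> A.Mods \<Longrightarrow> X' \<in> A.Mods \<Longrightarrow> Y \<in> A.Mods \<Longrightarrow> Y' \<in> A.Mods \<Longrightarrow>
    f \<in> module_homs X X' \<Longrightarrow> g \<in> module_homs Y Y' \<Longrightarrow>
    J X' Y' * kronecker (Fm X X' f) (Fm Y Y' g) =
    Fm (A.mtensor X Y) (A.mtensor X' Y') (kronecker f g) * J X Y"
  using J by (simp add: tensor_structure_def rep_category_def)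

text \<open>Associators are identity matrices between equal objects, so both they and their image
  under \<open>F\<close> drop out of the coherence square.\<close>

lemma J_assoc:
  assumes X: "X \<in> A.Mods" and Y: "Y \<in> A.Mods" and Z: "Z \<in> A.Mods"
  shows "J (A.mtensor X Y) Z * kronecker (J X Y) (1\<^sub>m (fst (F Z))) =
    J X (A.mtensor Y Z) * kronecker (1\<^sub>m (fst (F X))) (J Y Z)"
proof -
  have "Fm (A.mtensor (A.mtensor X Y) Z) (A.mtensor X (A.mtensor Y Z)) (1\<^sub>m (fst X * fst Y * fst Z)) *
    (J (A.mtensor X Y) Z * kronecker (J X Y) (1\<^sub>m (fst (F Z)))) =
    J X (A.mtensor Y Z) * (kronecker (1\<^sub>m (fst (F X))) (J Y Z) * 1\<^sub>m (fst (F X) * fst (F Y) * fst (F Z)))"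
    using J X Y Z by (simp add: tensor_structure_def rep_category_def)
  moreover have "Fm (A.mtensor (A.mtensor X Y) Z) (A.mtensor X (A.mtensor Y Z)) (1\<^sub>m (fst X * fst Y * fst Z)) =
    1\<^sub>m (fst (F (A.mtensor X (A.mtensor Y Z))))"
    using F_one[of "A.mtensor X (A.mtensor Y Z)"]
    by (simp add: A.module_tensor_assoc[OF X Y Z] A.module_tensor_closed X Y Z mult.assoc)
  ultimately show ?thesis
    using X Y Z by (simp add: one_mult_mat_dim A.module_tensor_closed A.module_tensor_assoc mult.assoc)
qed

lemma J_unit:
  assumes X: "X \<in> A.Mods"
  shows "J A.munit X * kronecker j (1\<^sub>m (fst (F X))) = 1\<^sub>m (fst (F X))"
    and "J X A.munit * kronecker (1\<^sub>m (fst (F X))) j = 1\<^sub>m (fst (F X))"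
proof -
  have "1\<^sub>m (fst (F X)) = Fm (A.mtensor A.munit X) X (1\<^sub>m (fst X)) *
      (J A.munit X * kronecker j (1\<^sub>m (fst (F X))))"
    "1\<^sub>m (fst (F X)) = Fm (A.mtensor X A.munit) X (1\<^sub>m (fst X)) *
      (J X A.munit * kronecker (1\<^sub>m (fst (F X))) j)"
    using J X unfolding tensor_structure_def munit_eq by (simp_all add: rep_category_def)
  then show "J A.munit X * kronecker j (1\<^sub>m (fst (F X))) = 1\<^sub>m (fst (F X))"
    "J X A.munit * kronecker (1\<^sub>m (fst (F X))) j = 1\<^sub>m (fst (F X))"
    by (simp_all add: A.module_tensor_unit X F_one one_mult_mat_dim A.munit_closed)
qed

text \<open>Let P and Q be the actions of \<Lambda> on X and of \<Lambda>' on F X. Both F(P) and Q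
  fix every morphism from the trivial module to F X, and the columns of P and Q are morphisms from
  the respective trivial modules. Hence F(P) Q = Q and Q F(P) = F(P); since F(P) and Q commute, they
  are equal.\<close>

lemma F_integral:
  assumes X: "X \<in> A.Mods"
  shows "Fm X X (snd X \<Lambda>) = snd (F X) \<Lambda>'"
proof -
  let ?P = "snd X \<Lambda>" and ?Q = "snd (F X) \<Lambda>'" and ?n = "fst X" and ?m = "fst (F X)"
  have FX: "F X \<in> B.Mods" by (rule F_obj[OF X])
  have P: "?P \<in> carrier_mat ?n ?n" and Q: "?Q \<in> carrier_mat ?m ?m"
    by (rule fd_modulesD(1)[OF X] fd_modulesD(1)[OF FX])+
  have Ph: "?P \<in> module_homs X X" by (rule A.integral_homs(3)[OF X integral])
  have Qh: "?Q \<in> module_homs (F X) (F X)" by (rule B.integral_homs(3)[OF FX integral'])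
  note FPh = F_hom[OF X X Ph]
  have FP: "Fm X X ?P \<in> carrier_mat ?m ?m" by (rule module_homsD(1)[OF FPh])
  have "?P * ?P = ?P"
    using integral by (simp flip: fd_modulesD(3)[OF X] add: is_left_integral_def)
  have "?Q * ?Q = ?Q"
    using integral' by (simp flip: fd_modulesD(3)[OF FX] add: is_left_integral_def)
  obtain j' where j': "module_iso B.munit (F A.munit) j j'" using j_iso by blast
  note j = module_isoD[OF j']
  \<comment> \<open>Up to \<open>j\<close>, a map from the trivial module to F X is F of a map from
    the trivial module to X, by fullness; on the latter P acts by \<epsilon>(\<Lambda>) = 1.\<close>
  have abs: "Fm X X ?P * f = f" if f: "f \<in> module_homs B.munit (F X)" for f
  proof -
    have "f * j' \<in> module_homs (F A.munit) (F X)"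
      by (rule module_homs_comp[OF j(2) f F_obj[OF A.munit_closed] B.munit_closed FX])
    then obtain g where g: "g \<in> module_homs A.munit X" "Fm A.munit X g = f * j'"
      using F_full[OF A.munit_closed X] by blast
    have "?P * g = g * snd A.munit \<Lambda>" by (rule module_homsD(2)[OF g(1), symmetric])
    also have "\<dots> = g" using module_homsD(1)[OF g(1)] by (simp add: A.munit_def integral one_smult_mat)
    finally have "?P * g = g" .
    then have "Fm X X ?P * (f * j') = f * j'"
      using F_comp[OF A.munit_closed X X g(1) Ph] by (simp add: g(2))
    then have "Fm X X ?P * f * j' * j = f * j' * j"
      using FP module_homsD(1)[OF f] by (simp add: mult_mat_assoc j)
    then show ?thesis
      using FP module_homsD(1)[OF f] by (simp add: mult_mat_assoc j one_mult_mat_dim)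
  qed
  have PQ: "Fm X X ?P * ?Q = ?Q"
  proof (rule eq_matI)
    fix i k assume "i < dim_row ?Q" "k < dim_col ?Q"
    then have ik: "i < ?m" "k < ?m" using Q by auto
    have "col_mat (Fm X X ?P * ?Q) k = col_mat ?Q k"
      using abs[OF B.integral_homs(1)[OF FX integral' ik(2)]] mult_col_mat[OF FP Q ik(2)] by simp
    from arg_cong[OF this, of "\<lambda>M. M $$ (i, 0)"] show "(Fm X X ?P * ?Q) $$ (i, k) = ?Q $$ (i, k)"
      using ik FP Q by (simp add: col_mat_def)
  qed (use FP Q in auto)
  \<comment> \<open>Q is pulled back to an endomorphism \<open>q\<close> of X, so that the second
    identity can be checked on the columns of P before applying \<open>F\<close>.\<close>
  obtain q where q: "q \<in> module_homs X X" "Fm X X q = ?Q"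
    using F_full[OF X X Qh] by blast
  note qc = module_homsD(1)[OF q(1)]
  have absq: "q * f = f" if f: "f \<in> module_homs A.munit X" for f
  proof -
    let ?f = "Fm A.munit X f"
    have h: "?f * j \<in> module_homs B.munit (F X)"
      by (rule module_homs_comp[OF j(1) F_hom[OF A.munit_closed X f] B.munit_closed F_obj[OF A.munit_closed] FX])
    have "?Q * (?f * j) = ?f * j * snd B.munit \<Lambda>'"
      by (rule module_homsD(2)[OF h, symmetric])
    also have "\<dots> = ?f * j"
      by (simp add: B.munit_def integral' one_smult_mat one_mult_mat_dim j)
    finally have "?Q * (?f * j) * j' = ?f * j * j'" by simp
    then have "?Q * ?f = ?f"
      using Q carrier_matD[OF module_homsD(1)[OF F_hom[OF A.munit_closed X f]]]
      by (simp add: mult_mat_assoc j one_mult_mat_dim)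
    then have "Fm A.munit X (q * f) = ?f"
      using F_comp[OF A.munit_closed X X f q(1)] q(2) by simp
    then show ?thesis
      by (rule F_faithful[OF A.munit_closed X module_homs_comp[OF f q(1) A.munit_closed X X] f])
  qed
  have "q * ?P = ?P"
  proof (rule eq_matI)
    fix i k assume "i < dim_row ?P" "k < dim_col ?P"
    then have ik: "i < ?n" "k < ?n" using P by auto
    have "col_mat (q * ?P) k = col_mat ?P k"
      using absq[OF A.integral_homs(1)[OF X integral ik(2)]] mult_col_mat[OF qc P ik(2)] by simp
    from arg_cong[OF this, of "\<lambda>M. M $$ (i, 0)"] show "(q * ?P) $$ (i, k) = ?P $$ (i, k)"
      using ik qc P by (simp add: col_mat_def)
  qed (use P qc in auto)
  then have "?Q * Fm X X ?P = Fm X X ?P"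
    using F_comp[OF X X X Ph q(1)] q(2) by simp
  \<comment> \<open>F(P) is a module endomorphism and Q is the action of an element, so they
    commute.\<close>
  moreover have "Fm X X ?P * ?Q = ?Q * Fm X X ?P" by (rule module_homsD(2)[OF FPh])
  ultimately show ?thesis using PQ by simp
qed

section \<open>Linearity of \<open>F\<close> on finite sums\<close>

lemma F_zero:
  assumes X: "X \<in> A.Mods" and Y: "Y \<in> A.Mods"
  shows "0\<^sub>m (fst Y) (fst X) \<in> module_homs X Y"
    and "Fm X Y (0\<^sub>m (fst Y) (fst X)) = 0\<^sub>m (fst (F Y)) (fst (F X))"
proof -
  show 0: "0\<^sub>m (fst Y) (fst X) \<in> module_homs X Y"
  proof -
    have "0\<^sub>m (fst Y) (fst X) * snd X a = snd Y a * 0\<^sub>m (fst Y) (fst X)" for a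
      using fd_modulesD(1)[OF X, of a] fd_modulesD(1)[OF Y, of a] by simp
    then show ?thesis by (simp add: module_homs_def)
  qed
  have "Fm X Y (0\<^sub>m (fst Y) (fst X)) = Fm X Y (0 \<cdot>\<^sub>m 0\<^sub>m (fst Y) (fst X))"
    by (rule arg_cong[where f = "Fm X Y"]) (rule eq_matI, auto)
  also have "\<dots> = 0 \<cdot>\<^sub>m Fm X Y (0\<^sub>m (fst Y) (fst X))" by (rule F_smult[OF X Y 0])
  also have "\<dots> = 0\<^sub>m (fst (F Y)) (fst (F X))"
    using module_homsD(1)[OF F_hom[OF X Y 0]] by (intro eq_matI) auto
  finally show "Fm X Y (0\<^sub>m (fst Y) (fst X)) = 0\<^sub>m (fst (F Y)) (fst (F X))" .
qed

text \<open>Both claims go through one induction, since additivity of \<open>F\<close> may be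
  applied only once the partial sum is known to be a morphism.\<close>

lemma F_mat_sum:
  assumes X: "X \<in> A.Mods" and Y: "Y \<in> A.Mods" and f: "\<And>k. k < N \<Longrightarrow> f k \<in> module_homs X Y"
  shows "mat_sum (fst Y) (fst X) f N \<in> module_homs X Y \<and>
    Fm X Y (mat_sum (fst Y) (fst X) f N) = mat_sum (fst (F Y)) (fst (F X)) (\<lambda>k. Fm X Y (f k)) N"
  using f
proof (induction N)
  case 0
  show ?case using F_zero[OF X Y] by (simp add: mat_sum_0)
next
  case (Suc N)
  have f: "f N \<in> module_homs X Y" using Suc.prems by simp
  have IH: "mat_sum (fst Y) (fst X) f N \<in> module_homs X Y"
    "Fm X Y (mat_sum (fst Y) (fst X) f N) = mat_sum (fst (F Y)) (fst (F X)) (\<lambda>k. Fm X Y (f k)) N"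
    using Suc by auto
  show ?case
    using module_homs_add[OF IH(1) f X Y] F_add[OF X Y IH(1) f]
    by (simp add: mat_sum_Suc module_homsD(1)[OF f] IH(2)
      mat_sum_Suc[of "\<lambda>k. Fm X Y (f k)", OF module_homsD(1)[OF F_hom[OF X Y f]]])
qed

text \<open>The coherence isomorphism from the tensor power of \<open>F V\<close> to \<open>F\<close> of the tensor power of \<open>V\<close>.\<close>

primrec J_pow :: "nat \<times> ('a \<Rightarrow> 'k mat) \<Rightarrow> nat \<Rightarrow> 'k mat" where
  "J_pow V 0 = 1\<^sub>m (fst (F V))"
| "J_pow V (Suc m) = J V (A.tensor_pow V m) * kronecker (1\<^sub>m (fst (F V))) (J_pow V m)"

lemma J_pow_iso:
  assumes V: "V \<in> A.Mods"
  shows "\<exists>g. module_iso (B.tensor_pow (F V) m) (F (A.tensor_pow V m)) (J_pow V m) g"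
proof (induction m)
  case 0
  show ?case using module_iso_refl[OF F_obj[OF V]] by auto
next
  case (Suc m)
  then obtain g where g: "module_iso (B.tensor_pow (F V) m) (F (A.tensor_pow V m)) (J_pow V m) g" by blast
  note FV = F_obj[OF V] and W = A.tensor_pow_closed[OF V, of m]
  note FW = F_obj[OF W] and W' = B.tensor_pow_closed[OF FV, of m]
  obtain h where h: "module_iso (B.mtensor (F V) (F (A.tensor_pow V m)))
      (F (A.mtensor V (A.tensor_pow V m))) (J V (A.tensor_pow V m)) h"
    using J_iso[OF V W] by blast
  show ?case
    using module_iso_comp[OF B.module_iso_kronecker[OF module_iso_refl[OF FV] g FV FV W' FW] h
        B.module_tensor_closed[OF FV W'] B.module_tensor_closed[OF FV FW]
        F_obj[OF A.module_tensor_closed[OF V W]]]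
    by auto
qed

lemma J_pow_dim [simp]:
  assumes "V \<in> A.Mods"
  shows "dim_row (J_pow V m) = fst (F (A.tensor_pow V m))"
    "dim_col (J_pow V m) = fst (B.tensor_pow (F V) m)"
proof -
  obtain g where "module_iso (B.tensor_pow (F V) m) (F (A.tensor_pow V m)) (J_pow V m) g"
    using J_pow_iso[OF assms] by blast
  from module_isoD(5,6)[OF this]
  show "dim_row (J_pow V m) = fst (F (A.tensor_pow V m))"
    "dim_col (J_pow V m) = fst (B.tensor_pow (F V) m)" by simp_all
qed

text \<open>The coherence isomorphism is the same whichever end the last factor joins;
  \<open>J_assoc\<close> passes the new factor across in the induction.\<close>

lemma J_pow_Suc_right:
  assumes V: "V \<in> A.Mods"
  shows "J (A.tensor_pow V m) V * kronecker (J_pow V m) (1\<^sub>m (fst (F V))) = J_pow V (Suc m)"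
proof (induction m)
  case 0
  show ?case by (simp add: kronecker_one)
next
  case (Suc m)
  let ?W = "A.tensor_pow V m" and ?d = "fst (F V)"
  note W = A.tensor_pow_closed[OF V, of m] and W' = A.tensor_pow_closed[OF V, of "Suc m"]
  have "J (A.mtensor V ?W) V * kronecker (J V ?W * kronecker (1\<^sub>m ?d) (J_pow V m)) (1\<^sub>m ?d) =
    J (A.mtensor V ?W) V * (kronecker (J V ?W) (1\<^sub>m ?d) *
      kronecker (kronecker (1\<^sub>m ?d) (J_pow V m)) (1\<^sub>m ?d))"
    by (simp add: kronecker_mult_dim one_mult_mat_dim V W)
  also have "\<dots> = J (A.mtensor V ?W) V * kronecker (J V ?W) (1\<^sub>m ?d) *
      kronecker (1\<^sub>m ?d) (kronecker (J_pow V m) (1\<^sub>m ?d))"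
    by (simp add: mult_mat_assoc V W A.module_tensor_closed kronecker_assoc mult.assoc)
  also have "\<dots> = J V (A.mtensor ?W V) * kronecker (1\<^sub>m ?d) (J ?W V) *
      kronecker (1\<^sub>m ?d) (kronecker (J_pow V m) (1\<^sub>m ?d))"
    by (simp only: J_assoc[OF V W V])
  also have "\<dots> = J V (A.mtensor ?W V) * kronecker (1\<^sub>m ?d) (J ?W V * kronecker (J_pow V m) (1\<^sub>m ?d))"
    by (simp add: mult_mat_assoc V W A.module_tensor_closed kronecker_mult_dim one_mult_mat_dim)
  also have "\<dots> = J V (A.tensor_pow V (Suc m)) * kronecker (1\<^sub>m ?d) (J_pow V (Suc m))"
    by (simp only: Suc.IH A.tensor_pow_Suc_right[OF V])
  finally show ?case by simp
qed

text \<open>\<open>u'\<close> and \<open>w'\<close> are \<open>u\<close> and \<open>w\<close>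
  transported along \<open>J_pow\<close> and \<open>j\<close>. Writing a contraction as a composite
  through the tensor power with \<open>m + 2\<close> factors, the image under \<open>F\<close> of
  each half differs from its counterpart for \<open>u'\<close> or \<open>w'\<close> by the same
  \<open>J_pow V (Suc m)\<close>, so the two corrections match in the middle.\<close>

lemma F_contract:
  assumes V: "V \<in> A.Mods"
    and u: "u \<in> module_homs A.munit (A.tensor_pow V m)" and w: "w \<in> module_homs (A.tensor_pow V m) A.munit"
    and g: "module_iso (B.tensor_pow (F V) m) (F (A.tensor_pow V m)) (J_pow V m) g"
    and j': "module_iso B.munit (F A.munit) j j'"
  defines "u' \<equiv> g * (Fm A.munit (A.tensor_pow V m) u * j)"
    and "w' \<equiv> j' * (Fm (A.tensor_pow V m) A.munit w * J_pow V m)"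
  shows "contract (fst V) (fst V ^ m) (u * w) \<in> module_homs V V"
    and "Fm V V (contract (fst V) (fst V ^ m) (u * w)) = contract (fst (F V)) (fst (F V) ^ m) (u' * w')"
    and "contract_rev (fst V) (fst V ^ m) (u * w) \<in> module_homs V V"
    and "Fm V V (contract_rev (fst V) (fst V ^ m) (u * w)) = contract_rev (fst (F V)) (fst (F V) ^ m) (u' * w')"
proof -
  let ?W = "A.tensor_pow V m" and ?d = "fst V" and ?d' = "fst (F V)"
  let ?U = "A.mtensor V ?W"
  note W = A.tensor_pow_closed[OF V, of m] and U = A.module_tensor_closed[OF V A.tensor_pow_closed[OF V, of m]]
  note FV = F_obj[OF V] and FW = F_obj[OF W] and un = A.munit_closed
  note gd = module_isoD[OF g] and jd = module_isoD[OF j']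
  note Fu = carrier_matD[OF module_homsD(1)[OF F_hom[OF un W u]]]
    and Fw = carrier_matD[OF module_homsD(1)[OF F_hom[OF W un w]]]
  note dims = gd(5-8) jd(5-8) Fu Fw one_mult_mat_dim V W un
  have uc: "u \<in> carrier_mat (?d * ?d ^ m) 1" and wc: "w \<in> carrier_mat 1 (?d * ?d ^ m)"
    using module_homsD(1)[OF u] module_homsD(1)[OF w] by (simp_all add: A.fst_tensor_pow)
  have uc': "u' \<in> carrier_mat (?d' * ?d' ^ m) 1" and wc': "w' \<in> carrier_mat 1 (?d' * ?d' ^ m)"
    unfolding u'_def w'_def by (intro carrier_matI; simp add: dims B.fst_tensor_pow)+
  note oneV = one_module_homs[OF V]
  have u1: "kronecker u (1\<^sub>m ?d) \<in> module_homs V ?U"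
    using A.kronecker_module_homs[OF un W V V u oneV] A.tensor_pow_Suc_right[OF V, of m]
    by (simp add: A.module_tensor_unit V)
  have w1: "kronecker w (1\<^sub>m ?d) \<in> module_homs ?U V"
    using A.kronecker_module_homs[OF W un V V w oneV] A.tensor_pow_Suc_right[OF V, of m]
    by (simp add: A.module_tensor_unit V)
  have u2: "kronecker (1\<^sub>m ?d) u \<in> module_homs V ?U"
    using A.kronecker_module_homs[OF V V un W oneV u] by (simp add: A.module_tensor_unit V)
  have w2: "kronecker (1\<^sub>m ?d) w \<in> module_homs ?U V"
    using A.kronecker_module_homs[OF V V W un oneV w] by (simp add: A.module_tensor_unit V)
  note Fu1 = carrier_matD[OF module_homsD(1)[OF F_hom[OF V U u1]]]
    and Fu2 = carrier_matD[OF module_homsD(1)[OF F_hom[OF V U u2]]]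
    and Fw1 = carrier_matD[OF module_homsD(1)[OF F_hom[OF U V w1]]]
    and Fw2 = carrier_matD[OF module_homsD(1)[OF F_hom[OF U V w2]]]
  \<comment> \<open>By the unit coherence, these components of \<open>J\<close> are inverse to
    \<open>j\<close> tensored with an identity.\<close>
  have Ju: "J V A.munit = kronecker (1\<^sub>m ?d') j'" "J A.munit V = kronecker j' (1\<^sub>m ?d')"
  proof -
    have "J V A.munit * kronecker (1\<^sub>m ?d') j * kronecker (1\<^sub>m ?d') j' = J V A.munit"
      "J A.munit V * kronecker j (1\<^sub>m ?d') * kronecker j' (1\<^sub>m ?d') = J A.munit V"
      by (simp_all add: mult_mat_assoc kronecker_mult_dim dims jd kronecker_one)
    then show "J V A.munit = kronecker (1\<^sub>m ?d') j'" "J A.munit V = kronecker j' (1\<^sub>m ?d')"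
      unfolding J_unit[OF V] by (simp_all add: one_mult_mat_dim jd)
  qed
  \<comment> \<open>The recursion for \<open>J_pow V (Suc m)\<close> is solved for \<open>J\<close>,
    once for each end at which the extra factor may join.\<close>
  have JW: "J V ?W = J_pow V (Suc m) * kronecker (1\<^sub>m ?d') g" "J ?W V = J_pow V (Suc m) * kronecker g (1\<^sub>m ?d')"
    by (simp add: mult_mat_assoc kronecker_mult_dim dims gd(4) kronecker_one)
      (simp add: J_pow_Suc_right[OF V, symmetric] mult_mat_assoc kronecker_mult_dim dims gd(4) kronecker_one
        del: J_pow.simps)
  have e1: "Fm V ?U (kronecker u (1\<^sub>m ?d)) = J_pow V (Suc m) * kronecker u' (1\<^sub>m ?d')"
  proof -
    have "Fm V ?U (kronecker u (1\<^sub>m ?d)) = Fm V ?U (kronecker u (1\<^sub>m ?d)) * (J A.munit V * kronecker j (1\<^sub>m ?d'))"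
      by (simp add: J_unit[OF V] dims Fu1)
    also have "\<dots> = J ?W V * kronecker (Fm A.munit ?W u) (1\<^sub>m ?d') * kronecker j (1\<^sub>m ?d')"
      using J_nat[OF un W V V u oneV] A.tensor_pow_Suc_right[OF V, of m]
      by (simp add: mult_mat_assoc[symmetric] dims Fu1 A.module_tensor_unit F_one)
    also have "\<dots> = J_pow V (Suc m) * kronecker u' (1\<^sub>m ?d')"
      unfolding JW u'_def by (simp add: mult_mat_assoc kronecker_mult_dim dims del: J_pow.simps)
    finally show ?thesis .
  qed
  have e2: "Fm V ?U (kronecker (1\<^sub>m ?d) u) = J_pow V (Suc m) * kronecker (1\<^sub>m ?d') u'"
  proof -
    have "Fm V ?U (kronecker (1\<^sub>m ?d) u) = Fm V ?U (kronecker (1\<^sub>m ?d) u) * (J V A.munit * kronecker (1\<^sub>m ?d') j)"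
      by (simp add: J_unit[OF V] dims Fu2)
    also have "\<dots> = J V ?W * kronecker (1\<^sub>m ?d') (Fm A.munit ?W u) * kronecker (1\<^sub>m ?d') j"
      using J_nat[OF V V un W oneV u]
      by (simp add: mult_mat_assoc[symmetric] dims Fu2 A.module_tensor_unit F_one)
    also have "\<dots> = J_pow V (Suc m) * kronecker (1\<^sub>m ?d') u'"
      unfolding JW u'_def by (simp add: mult_mat_assoc kronecker_mult_dim dims del: J_pow.simps)
    finally show ?thesis .
  qed
  \<comment> \<open>No coherence map remains on the target side: the target is V tensored with the
    trivial module, which equals V, and \<open>Ju\<close> turns \<open>J\<close> into the
    \<open>j'\<close> occurring in \<open>w'\<close>.\<close>
  have e3: "Fm ?U V (kronecker (1\<^sub>m ?d) w) * J_pow V (Suc m) = kronecker (1\<^sub>m ?d') w'"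
  proof -
    have "Fm ?U V (kronecker (1\<^sub>m ?d) w) * J_pow V (Suc m) =
      Fm ?U V (kronecker (1\<^sub>m ?d) w) * J V ?W * kronecker (1\<^sub>m ?d') (J_pow V m)"
      using Fw2 by (simp add: mult_mat_assoc dims)
    also have "\<dots> = J V A.munit * kronecker (1\<^sub>m ?d') (Fm ?W A.munit w) * kronecker (1\<^sub>m ?d') (J_pow V m)"
      using J_nat[OF V V W un oneV w] by (simp add: A.module_tensor_unit F_one V)
    also have "\<dots> = kronecker (1\<^sub>m ?d') w'"
      unfolding Ju w'_def by (simp add: mult_mat_assoc kronecker_mult_dim dims)
    finally show ?thesis .
  qed
  have e4: "Fm ?U V (kronecker w (1\<^sub>m ?d)) * J_pow V (Suc m) = kronecker w' (1\<^sub>m ?d')"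
  proof -
    have "Fm ?U V (kronecker w (1\<^sub>m ?d)) * J_pow V (Suc m) =
      Fm ?U V (kronecker w (1\<^sub>m ?d)) * J ?W V * kronecker (J_pow V m) (1\<^sub>m ?d')"
      using Fw1 A.tensor_pow_Suc_right[OF V, of m]
      by (simp add: J_pow_Suc_right[OF V, symmetric] mult_mat_assoc dims del: J_pow.simps)
    also have "\<dots> = J A.munit V * kronecker (Fm ?W A.munit w) (1\<^sub>m ?d') * kronecker (J_pow V m) (1\<^sub>m ?d')"
      using J_nat[OF W un V V w oneV] A.tensor_pow_Suc_right[OF V, of m]
      by (simp add: A.module_tensor_unit F_one V)
    also have "\<dots> = kronecker w' (1\<^sub>m ?d')"
      unfolding Ju w'_def by (simp add: mult_mat_assoc kronecker_mult_dim dims)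
    finally show ?thesis .
  qed
  note c = contract_outer_product[OF uc wc, symmetric] contract_outer_product[OF uc' wc', symmetric]
    contract_rev_outer_product[OF uc wc, symmetric] contract_rev_outer_product[OF uc' wc', symmetric]
  note ud = carrier_matD[OF uc'] carrier_matD[OF wc']
  show "contract ?d (?d ^ m) (u * w) \<in> module_homs V V"
    unfolding c by (rule module_homs_comp[OF u1 w2 V U V])
  show "contract_rev ?d (?d ^ m) (u * w) \<in> module_homs V V"
    unfolding c by (rule module_homs_comp[OF u2 w1 V U V])
  have Jd: "dim_row (J_pow V (Suc m)) = fst (F ?U)" "dim_col (J_pow V (Suc m)) = ?d' * (?d' * ?d' ^ m)"
    using J_pow_dim[OF V, of "Suc m"] by (simp_all add: B.fst_tensor_pow del: J_pow.simps)
  \<comment> \<open>After reassociation, the \<open>J_pow\<close> produced by \<open>e1\<close> is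
    exactly the one that \<open>e3\<close> absorbs.\<close>
  show "Fm V V (contract ?d (?d ^ m) (u * w)) = contract ?d' (?d' ^ m) (u' * w')"
    unfolding c F_comp[OF V U V u1 w2] e1 e3[symmetric]
    using Fw2 by (simp add: mult_mat_assoc Jd ud mult.commute del: J_pow.simps)
  show "Fm V V (contract_rev ?d (?d ^ m) (u * w)) = contract_rev ?d' (?d' ^ m) (u' * w')"
    unfolding c F_comp[OF V U V u2 w1] e2 e4[symmetric]
    using Fw1 by (simp add: mult_mat_assoc Jd ud mult.commute del: J_pow.simps)
qed

text \<open>The factorization of \<Lambda> through the trivial module is carried by \<open>F\<close>
  to one of \<Lambda>' on the tensor power of F V. Contraction is linear and \<open>F\<close> is
  additive, so it remains to use \<open>F_contract\<close> for each summand.\<close>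

lemma F_power_sum:
  assumes V: "V \<in> A.Mods"
  shows "snd V (A.power_sum m \<Lambda>) \<in> module_homs V V"
    and "Fm V V (snd V (A.power_sum m \<Lambda>)) = snd (F V) (B.power_sum m \<Lambda>')"
    and "snd V (A.rev_power_sum m \<Lambda>) \<in> module_homs V V"
    and "Fm V V (snd V (A.rev_power_sum m \<Lambda>)) = snd (F V) (B.rev_power_sum m \<Lambda>')"
proof -
  let ?W = "A.tensor_pow V m" and ?d = "fst V" and ?d' = "fst (F V)" and ?W' = "B.tensor_pow (F V) m"
  let ?P = "snd ?W \<Lambda>" and ?N = "?d * ?d ^ m" and ?N' = "?d' * ?d' ^ m" and ?J = "J_pow V m"
  note W = A.tensor_pow_closed[OF V, of m] and FV = F_obj[OF V] and un = A.munit_closed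
  note FW = F_obj[OF W] and W' = B.tensor_pow_closed[OF FV, of m]
  obtain g where g: "module_iso ?W' (F ?W) ?J g" using J_pow_iso[OF V] by blast
  obtain j' where j': "module_iso B.munit (F A.munit) j j'" using j_iso by blast
  note gd = module_isoD[OF g] and jd = module_isoD[OF j']
  define u where "u = col_mat ?P"
  define w where "w = row_mat ?P"
  define u' where "u' i = g * (Fm A.munit ?W (u i) * j)" for i
  define w' where "w' i = j' * (Fm ?W A.munit (w i) * ?J)" for i
  have N: "fst ?W = ?N" "fst ?W' = ?N'" by (simp_all add: A.fst_tensor_pow B.fst_tensor_pow)
  have P: "?P \<in> carrier_mat ?N ?N" using fd_modulesD(1)[OF W] N by metis
  have u: "u i \<in> module_homs A.munit ?W" and w: "w i \<in> module_homs ?W A.munit" if "i < ?N" for i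
    using A.integral_homs(1,2)[OF W integral] that by (simp_all add: u_def w_def N)
  have uw: "u i * w i \<in> module_homs ?W ?W" if "i < ?N" for i
    by (rule module_homs_comp[OF w[OF that] u[OF that] W un W])
  have "?P * ?P = ?P"
    using integral by (simp flip: fd_modulesD(3)[OF W] add: is_left_integral_def)
  then have Psum: "?P = mat_sum ?N ?N (\<lambda>i. u i * w i) ?N"
    using mult_eq_mat_sum[OF P P] by (simp add: u_def w_def)
  have FP: "mat_sum (fst (F ?W)) (fst (F ?W)) (\<lambda>i. Fm ?W ?W (u i * w i)) ?N = snd (F ?W) \<Lambda>'"
    using F_mat_sum[OF W W uw, of ?N "\<lambda>i. i"] Psum F_integral[OF W] by (simp add: N)
  have gc: "g \<in> carrier_mat ?N' (fst (F ?W))" and Jc: "?J \<in> carrier_mat (fst (F ?W)) ?N'"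
    using module_homsD(1)[OF gd(2)] module_homsD(1)[OF gd(1)] by (simp_all add: N)
  \<comment> \<open>The factor \<open>j * j'\<close> in the middle of \<open>u' i * w' i\<close>
    cancels, leaving a conjugate of F(u_i w_i) by \<open>J_pow\<close>.\<close>
  have uw': "u' i * w' i = g * Fm ?W ?W (u i * w i) * ?J" if "i < ?N" for i
  proof -
    note Fu = carrier_matD[OF module_homsD(1)[OF F_hom[OF un W u[OF that]]]]
      and Fw = carrier_matD[OF module_homsD(1)[OF F_hom[OF W un w[OF that]]]]
    show ?thesis
      unfolding F_comp[OF W un W w[OF that] u[OF that]] u'_def w'_def
      by (simp add: mult_mat_assoc Fu Fw gd(5-8) jd(5-8) module_iso_cancel[OF j'])
  qed
  \<comment> \<open>The number of summands stays \<open>?N\<close>, the dimension on the side of V: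
    the rank-one expansion is the transported one, not the one by columns of the action of
    \<Lambda>'.\<close>
  have "mat_sum ?N' ?N' (\<lambda>i. u' i * w' i) ?N = g * snd (F ?W) \<Lambda>' * ?J"
    unfolding FP[symmetric]
    by (subst mult_mat_sum[OF gc module_homsD(1)[OF F_hom[OF W W uw]] Jc])
      (auto intro: mat_sum_cong uw')
  also have "\<dots> = g * (?J * snd ?W' \<Lambda>')"
    using carrier_matD[OF fd_modulesD(1)[OF FW]] by (simp add: module_homsD(2)[OF gd(1)] mult_mat_assoc gd(5-8))
  also have "\<dots> = snd ?W' \<Lambda>'"
    by (rule module_iso_cancel[OF g]) (simp add: W')
  finally have P'sum: "snd ?W' \<Lambda>' = mat_sum ?N' ?N' (\<lambda>i. u' i * w' i) ?N" by simp
  have uwc: "u i * w i \<in> carrier_mat ?N ?N" if "i < ?N" for i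
    using module_homsD(1)[OF uw[OF that]] by (simp add: N)
  have uwc': "u' i * w' i \<in> carrier_mat ?N' ?N'" if "i < ?N" for i
    using gc Jc module_homsD(1)[OF F_hom[OF W W uw[OF that]]] by (simp add: uw'[OF that])
  have 1: "snd V (A.power_sum m \<Lambda>) = mat_sum ?d ?d (\<lambda>i. contract ?d (?d ^ m) (u i * w i)) ?N"
    "snd V (A.rev_power_sum m \<Lambda>) = mat_sum ?d ?d (\<lambda>i. contract_rev ?d (?d ^ m) (u i * w i)) ?N"
    unfolding A.contract_tensor_pow[OF V, symmetric] A.contract_rev_tensor_pow[OF V, symmetric]
    by (subst Psum, rule contract_mat_sum[OF uwc], assumption)+
  have 2: "snd (F V) (B.power_sum m \<Lambda>') = mat_sum ?d' ?d' (\<lambda>i. contract ?d' (?d' ^ m) (u' i * w' i)) ?N"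
    "snd (F V) (B.rev_power_sum m \<Lambda>') = mat_sum ?d' ?d' (\<lambda>i. contract_rev ?d' (?d' ^ m) (u' i * w' i)) ?N"
    unfolding B.contract_tensor_pow[OF FV, symmetric] B.contract_rev_tensor_pow[OF FV, symmetric]
    by (subst P'sum, rule contract_mat_sum[OF uwc'], assumption)+
  note F = F_contract[OF V u w g j', folded u'_def w'_def]
  show "snd V (A.power_sum m \<Lambda>) \<in> module_homs V V"
    "Fm V V (snd V (A.power_sum m \<Lambda>)) = snd (F V) (B.power_sum m \<Lambda>')"
    unfolding 1 2 using F_mat_sum[OF V V F(1)] F(2) by (auto intro: mat_sum_cong)
  show "snd V (A.rev_power_sum m \<Lambda>) \<in> module_homs V V"
    "Fm V V (snd V (A.rev_power_sum m \<Lambda>)) = snd (F V) (B.rev_power_sum m \<Lambda>')"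
    unfolding 1 2 using F_mat_sum[OF V V F(3)] F(4) by (auto intro: mat_sum_cong)
qed

text \<open>The isomorphism of centers induced by \<open>F\<close>, as a relation.\<close>

definition corresponds :: "'a \<Rightarrow> 'b \<Rightarrow> bool" where
  "corresponds a b \<longleftrightarrow> (\<forall>V\<in>A.Mods. snd V a \<in> module_homs V V \<and> Fm V V (snd V a) = snd (F V) b)"

section \<open>Corresponding elements are closed under the algebra operations\<close>

lemma corresponds_zero: "corresponds 0 0"
  by (simp add: corresponds_def fd_modules_zero[where s = scale] fd_modules_zero[OF F_obj] F_zero)

lemma corresponds_one: "corresponds 1 1"
  by (simp add: corresponds_def fd_modulesD(2)[where scale = scale] fd_modulesD(2)[OF F_obj] F_one
      one_module_homs[where s = scale])

lemma corresponds_add: "corresponds a b \<Longrightarrow> corresponds a' b' \<Longrightarrow> corresponds (a + a') (b + b')"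
  by (simp add: corresponds_def fd_modulesD(4)[where scale = scale] fd_modulesD(4)[OF F_obj] F_add
      module_homs_add[where s = scale])

lemma corresponds_mult: "corresponds a b \<Longrightarrow> corresponds a' b' \<Longrightarrow> corresponds (a * a') (b * b')"
  by (simp add: corresponds_def fd_modulesD(3)[where scale = scale] fd_modulesD(3)[OF F_obj]
      F_comp[of V V V for V] module_homs_comp[where s = scale and V = V and U = V for V])

lemma corresponds_scale:
  assumes "corresponds a b"
  shows "corresponds (scale c a) (scale' c b)"
proof -
  have "c \<cdot>\<^sub>m f \<in> module_homs V V" if "V \<in> A.Mods" "f \<in> module_homs V V" for V f
    using module_homsD[OF that(2)] fd_modulesD(1)[OF that(1)]
    by (simp add: module_homs_def mult_smult_assoc_mat[of _ "fst V" "fst V" _ "fst V"]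
        mult_smult_distrib[of _ "fst V" "fst V" _ "fst V"])
  then show ?thesis
    using assms by (simp add: corresponds_def fd_modulesD(5)[where scale = scale] fd_modulesD(5)[OF F_obj] F_smult)
qed

lemma corresponds_power: "corresponds a b \<Longrightarrow> corresponds (a ^ n) (b ^ n)"
  by (induction n) (auto intro: corresponds_one corresponds_mult)

lemma corresponds_eval_polynomial:
  assumes "\<And>i. corresponds (x i) (y i)"
  shows "corresponds (eval_polynomial scale s \<psi> x) (eval_polynomial scale' s \<psi> y)"
proof -
  have *: "corresponds (prod_list (map (\<lambda>i. x i ^ e i) l)) (prod_list (map (\<lambda>i. y i ^ e i) l))" for e and l :: "nat list"
    by (induction l) (auto intro: corresponds_one corresponds_mult corresponds_power assms)
  have sum: "(\<And>i. i \<in> I \<Longrightarrow> corresponds (f i) (h i)) \<Longrightarrow> corresponds (sum f I) (sum h I)"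
    for f h and I :: "'z set"
    by (induction I rule: infinite_finite_induct) (auto intro: corresponds_zero corresponds_add)
  show ?thesis
    unfolding eval_polynomial_def by (rule sum) (rule corresponds_scale[OF *])
qed

text \<open>Positive, zero and negative exponents reduce to \<open>power_sum\<close>, to 1 and to
  \<open>rev_power_sum\<close> respectively.\<close>

lemma corresponds_sweedler_power:
  "corresponds (sweedler_power scale \<Delta> \<epsilon> S n \<Lambda>) (sweedler_power scale' \<Delta>' \<epsilon>' S' n \<Lambda>')"
  unfolding A.sweedler_power_integral[OF integral] B.sweedler_power_integral[OF integral']
  using corresponds_one by (auto simp: corresponds_def F_power_sum)

text \<open>Vanishing is tested on a faithful module. From right to left, \<open>F\<close> is
  faithful on morphisms; from left to right, a faithful module of the second algebra lies in the
  essential image of \<open>F\<close>.\<close>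

lemma corresponds_eq_zero_iff:
  assumes "corresponds a b"
  shows "a = 0 \<longleftrightarrow> b = 0"
proof
  assume "b = 0"
  obtain V where V: "V \<in> A.Mods" and faith: "\<And>a. snd V a = 0\<^sub>m (fst V) (fst V) \<Longrightarrow> a = 0"
    using A.faithful_module by metis
  have "Fm V V (snd V a) = Fm V V (0\<^sub>m (fst V) (fst V))"
    using assms V \<open>b = 0\<close> by (simp add: corresponds_def F_zero fd_modules_zero[OF F_obj])
  moreover have "snd V a \<in> module_homs V V" using assms V by (simp add: corresponds_def)
  ultimately have "snd V a = 0\<^sub>m (fst V) (fst V)" using F_faithful[OF V V] F_zero[OF V V] by metis
  then show "a = 0" by (rule faith)
next
  assume "a = 0"
  obtain V where V: "V \<in> B.Mods" and faith: "\<And>b. snd V b = 0\<^sub>m (fst V) (fst V) \<Longrightarrow> b = 0"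
    using B.faithful_module by metis
  note GV = G_obj[OF V]
  have "snd (F (G V)) b = 0\<^sub>m (fst (F (G V))) (fst (F (G V)))"
    using assms[unfolded corresponds_def, rule_format, OF GV] \<open>a = 0\<close>
    by (simp add: F_zero[OF GV GV] fd_modules_zero[OF GV])
  moreover obtain h where h: "module_iso (F (G V)) V (\<theta> V) h" using \<theta>_iso[OF V] by blast
  note hd = module_isoD[OF h]
  \<comment> \<open>The isomorphism \<theta> carries the zero action of \<open>b\<close> on F(G V)
    to its action on V.\<close>
  have "snd V b * \<theta> V * h = \<theta> V * snd (F (G V)) b * h"
    by (simp add: module_homsD(2)[OF hd(1)])
  ultimately have "snd V b = 0\<^sub>m (fst V) (fst V)"
    using V module_homsD(1)[OF hd(1)] module_homsD(1)[OF hd(2)]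
    by (simp add: mult_mat_assoc hd(4-8) one_mult_mat_dim)
  then show "b = 0" by (rule faith)
qed

end

theorem proposition4p3:
  fixes scale :: "'k::field \<Rightarrow> 'a::ring_1 \<Rightarrow> 'a"
    and \<Delta> :: "'a \<Rightarrow> ('a \<times> 'a) list" and \<epsilon> :: "'a \<Rightarrow> 'k" and S :: "'a \<Rightarrow> 'a"
    and scale' :: "'k \<Rightarrow> 'b::ring_1 \<Rightarrow> 'b"
    and \<Delta>' :: "'b \<Rightarrow> ('b \<times> 'b) list" and \<epsilon>' :: "'b \<Rightarrow> 'k" and S' :: "'b \<Rightarrow> 'b"
    and \<Lambda> :: 'a and \<Lambda>' :: 'b
    and s :: nat and \<psi> :: "'k polynomial" and n :: "nat \<Rightarrow> int"
  assumes "hopf_algebra scale \<Delta> \<epsilon> S" and "hopf_algebra scale' \<Delta>' \<epsilon>' S'"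
    and "semisimple_ring TYPE('a)" and "semisimple_ring TYPE('b)"
    and "gauge_equivalent scale \<Delta> \<epsilon> scale' \<Delta>' \<epsilon>'"
    and "is_left_integral scale \<epsilon> \<Lambda>" and "\<Lambda> * \<Lambda> = \<Lambda>" and "\<Lambda> \<noteq> 0"
    and "is_left_integral scale' \<epsilon>' \<Lambda>'" and "\<Lambda>' * \<Lambda>' = \<Lambda>'" and "\<Lambda>' \<noteq> 0"
    and "polynomial_in s \<psi>"
  shows "eval_polynomial scale s \<psi> (\<lambda>i. sweedler_power scale \<Delta> \<epsilon> S (n i) \<Lambda>) = 0 \<longleftrightarrow>
    eval_polynomial scale' s \<psi> (\<lambda>i. sweedler_power scale' \<Delta>' \<epsilon>' S' (n i) \<Lambda>') = 0"
proof -
  interpret A: hopf_algebra scale \<Delta> \<epsilon> S by fact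
  interpret B: hopf_algebra scale' \<Delta>' \<epsilon>' S' by fact
  have e: "\<epsilon> \<Lambda> = 1" "\<epsilon>' \<Lambda>' = 1"
    using assms by (simp_all add: A.counit_idempotent_integral B.counit_idempotent_integral)
  obtain F Fm J j G Gm \<eta> \<theta> where
    "gauge_equivalence scale \<Delta> \<epsilon> S scale' \<Delta>' \<epsilon>' S' F Fm G Gm \<eta> \<theta> J j \<Lambda> \<Lambda>'"
    using assms e
    unfolding gauge_equivalent_def tensor_equivalent_def linear_equivalence_def
      gauge_equivalence_def gauge_equivalence_axioms_def by blast
  then interpret gauge_equivalence scale \<Delta> \<epsilon> S scale' \<Delta>' \<epsilon>' S' F Fm G Gm \<eta> \<theta> J j \<Lambda> \<Lambda>' .
  show ?thesis
    by (intro corresponds_eq_zero_iff corresponds_eval_polynomial corresponds_sweedler_power)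
qed

end
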